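(* Let $n\ge 1$ and let $(M^{2n+1},\phi,\zeta,\eta,g)$ be a para-Kenmotsu manifold. Suppose $M$ admits a proper $h$-almost Ricci-Yamabe soliton $(g,\zeta,\lambda,\alpha,\beta)$ with soliton vector field $\zeta$, i.e. there are smooth functions $h,\lambda:M\to\mathbb{R}$ and constants $\alpha,\beta\in\mathbb{R}$ with $\alpha\neq 0,1$ such that $$\frac{h}{2}\pounds_\zeta g+\alpha S+\Big(\lambda-\frac{\beta}{2}r\Big)g=0 .$$ Then $M$ is an $\eta$-Einstein manifold.
   Context: All objects are smooth. $\nabla$ is the Levi-Civita connection of the semi-Riemannian metric $g$, $R(X,Y)Z=\nabla_X\nabla_YZ-\nabla_Y\nabla_XZ-\nabla_{[X,Y]}Z$, $S(Y,Z)=\mathrm{tr}(X\mapsto R(X,Y)Z)$ is the Ricci tensor, $r$ the scalar curvature, $\pounds$ the Lie derivative. Almost paracontact metric manifold $(M^{2n+1},\phi,\zeta,\eta,g)$: $\phi$ is a $(1,1)$-tensor field, $\zeta$ a vector field, $\eta$ a 1-form, with $\phi^2=I-\eta\otimes\zeta$, $\eta(\zeta)=1$, the $\pm1$-eigendistributions of $\phi$ on $\ker\eta$ both have dimension $n$, and $g$ is a semi-Riemannian metric with $g(\phi X,\phi Y)=-g(X,Y)+\eta(X)\eta(Y)$. It follows that $\phi\zeta=0$, $\eta\circ\phi=0$, $\eta=g(\cdot,\zeta)$. The fundamental 2-form is $\Phi(X,Y)=g(X,\phi Y)$. Normal: the tensor $[\phi,\phi]-2d\eta\otimes\zeta$ vanishes,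 where $[\phi,\phi]$ is the Nijenhuis torsion of $\phi$ and $2d\eta(X,Y)=X\eta(Y)-Y\eta(X)-\eta([X,Y])$. Para-Kenmotsu manifold: a normal almost paracontact metric manifold with $d\eta=0$ and $d\Phi=2\eta\wedge\Phi$. Such a manifold satisfies $(\nabla_X\phi)Y=g(\phi X,Y)\zeta-\eta(Y)\phi X$, $\nabla_X\zeta=X-\eta(X)\zeta$, $R(X,Y)\zeta=\eta(X)Y-\eta(Y)X$ and $S(X,\zeta)=-2n\,\eta(X)$. $\eta$-Einstein: $S=a\,g+b\,\eta\otimes\eta$ for some smooth functions $a,b$ on $M$. *)

theory Defs
  imports "HOL-Analysis.Analysis" "HOL-Library.Function_Algebras"
begin

section \<open>Smooth manifolds\<close>

text \<open>The following is meant for open sets \<open>S\<close> only.\<close>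

primrec ck_on :: "nat \<Rightarrow> 'a::euclidean_space set \<Rightarrow> ('a \<Rightarrow> 'b::real_normed_vector) \<Rightarrow> bool" where
  "ck_on 0 S f \<longleftrightarrow> continuous_on S f"
| "ck_on (Suc k) S f \<longleftrightarrow>
     (\<forall>x\<in>S. f differentiable (at x)) \<and>
     (\<forall>v. ck_on k S (\<lambda>x. frechet_derivative f (at x) v))"

definition smooth_on :: "'a::euclidean_space set \<Rightarrow> ('a \<Rightarrow> 'b::real_normed_vector) \<Rightarrow> bool" where
  "smooth_on S f \<longleftrightarrow> (\<forall>k. ck_on k S f)"

text \<open>The manifold is the whole type \<open>'m\<close>; a chart is a pair \<open>(U, c)\<close> of its domain and its
  coordinate map, the values of \<open>c\<close> outside \<open>U\<close> being irrelevant.\<close>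

type_synonym ('m, 'e) chart = "'m set \<times> ('m \<Rightarrow> 'e)"

definition smooth_atlas ::
  "('m::{second_countable_topology, t2_space}, 'e::euclidean_space) chart set \<Rightarrow> bool" where
  "smooth_atlas A \<longleftrightarrow>
     (\<Union>(U, c)\<in>A. U) = UNIV \<and>
     (\<forall>(U, c)\<in>A. open U \<and> open (c ` U) \<and> homeomorphism U (c ` U) c (inv_into U c)) \<and>
     (\<forall>(U, c)\<in>A. \<forall>(V, d)\<in>A. smooth_on (c ` (U \<inter> V)) (d \<circ> inv_into U c))"

definition smooth_fun ::
  "('m::topological_space, 'e::euclidean_space) chart set \<Rightarrow> 'm set \<Rightarrow> ('m \<Rightarrow> real) \<Rightarrow> bool" where
  "smooth_fun A W f \<longleftrightarrow> (\<forall>(U, c)\<in>A. smooth_on (c ` (U \<inter> W)) (f \<circ> inv_into U c))"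

definition smooth_near ::
  "('m::topological_space, 'e::euclidean_space) chart set \<Rightarrow> 'm \<Rightarrow> ('m \<Rightarrow> real) \<Rightarrow> bool" where
  "smooth_near A p f \<longleftrightarrow> (\<exists>W. open W \<and> p \<in> W \<and> smooth_fun A W f)"

section \<open>Tangent vectors and vector fields\<close>

text \<open>Tangent vectors at \<open>p\<close> are directional derivative operators on functions that are smooth
  near \<open>p\<close>.  They are set to \<open>0\<close> on all other functions, so that equality of tangent vectors is
  equality of HOL functions.  In coordinates \<open>(U, c)\<close> the operator \<open>coord_vec A (U, c) p u\<close> is
  \<open>\<Sum>i. u\<^sup>i \<partial>/\<partial>x\<^sup>i\<close> at \<open>p\<close>.\<close>

type_synonym 'm tvec = "('m \<Rightarrow> real) \<Rightarrow> real"
type_synonym 'm vfield = "'m \<Rightarrow> 'm tvec"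

definition coord_vec ::
  "('m::topological_space, 'e::euclidean_space) chart set \<Rightarrow> ('m, 'e) chart \<Rightarrow> 'm \<Rightarrow> 'e \<Rightarrow> 'm tvec"
  where
  "coord_vec A C p u =
     (\<lambda>f. if smooth_near A p f
          then frechet_derivative (f \<circ> inv_into (fst C) (snd C)) (at (snd C p)) u else 0)"

definition tangent_space ::
  "('m::topological_space, 'e::euclidean_space) chart set \<Rightarrow> 'm \<Rightarrow> 'm tvec set" where
  "tangent_space A p = {coord_vec A C p u | C u. C \<in> A \<and> p \<in> fst C}"

text \<open>Addition and subtraction of tangent vectors are those of \<open>Function_Algebras\<close>.\<close>

definition fscale :: "real \<Rightarrow> ('a \<Rightarrow> real) \<Rightarrow> 'a \<Rightarrow> real"  (infixr "*\<^sub>f" 75) where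
  "c *\<^sub>f v = (\<lambda>x. c * v x)"

interpretation fun_space: vector_space "fscale :: real \<Rightarrow> ('a \<Rightarrow> real) \<Rightarrow> 'a \<Rightarrow> real"
  by unfold_locales (auto simp: fscale_def fun_eq_iff algebra_simps)

definition linear_on :: "'a tvec set \<Rightarrow> ('a tvec \<Rightarrow> real) \<Rightarrow> bool" where
  "linear_on V F \<longleftrightarrow>
     (\<forall>v\<in>V. \<forall>w\<in>V. F (v + w) = F v + F w) \<and> (\<forall>c. \<forall>v\<in>V. F (c *\<^sub>f v) = c * F v)"

definition endomorphism_on :: "'a tvec set \<Rightarrow> ('a tvec \<Rightarrow> 'a tvec) \<Rightarrow> bool" where
  "endomorphism_on V F \<longleftrightarrow>
     (\<forall>v\<in>V. F v \<in> V) \<and>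
     (\<forall>v\<in>V. \<forall>w\<in>V. F (v + w) = F v + F w) \<and> (\<forall>c. \<forall>v\<in>V. F (c *\<^sub>f v) = c *\<^sub>f F v)"

text \<open>The trace of an endomorphism of a finite-dimensional subspace \<open>V\<close>; it does not depend on
  the choice of the basis.\<close>

definition trace_on :: "'a tvec set \<Rightarrow> ('a tvec \<Rightarrow> 'a tvec) \<Rightarrow> real" where
  "trace_on V F =
     (let B = (SOME B. fun_space.independent B \<and> fun_space.span B = V)
      in \<Sum>e\<in>B. fun_space.representation B (F e) e)"

text \<open>Vector fields are considered on arbitrary open sets \<open>W\<close>; a vector field on \<open>W\<close> is
  represented by a total function whose values outside \<open>W\<close> are irrelevant.\<close>

definition smooth_vfield ::
  "('m::topological_space, 'e::euclidean_space) chart set \<Rightarrow> 'm set \<Rightarrow> 'm vfield \<Rightarrow> bool" where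
  "smooth_vfield A W X \<longleftrightarrow>
     open W \<and> (\<forall>p\<in>W. X p \<in> tangent_space A p) \<and>
     (\<forall>V f. open V \<and> V \<subseteq> W \<and> smooth_fun A V f \<longrightarrow> smooth_fun A V (\<lambda>p. X p f))"

definition lie_bracket ::
  "('m::topological_space, 'e::euclidean_space) chart set \<Rightarrow> 'm vfield \<Rightarrow> 'm vfield \<Rightarrow> 'm vfield"
  where
  "lie_bracket A X Y =
     (\<lambda>p f. if smooth_near A p f then X p (\<lambda>q. Y q f) - Y p (\<lambda>q. X q f) else 0)"

section \<open>Tensor fields\<close>

type_synonym 'm form1 = "'m \<Rightarrow> 'm tvec \<Rightarrow> real"
type_synonym 'm form2 = "'m \<Rightarrow> 'm tvec \<Rightarrow> 'm tvec \<Rightarrow> real"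
type_synonym 'm tensor11 = "'m \<Rightarrow> 'm tvec \<Rightarrow> 'm tvec"

definition smooth_form1 ::
  "('m::topological_space, 'e::euclidean_space) chart set \<Rightarrow> 'm form1 \<Rightarrow> bool" where
  "smooth_form1 A \<eta> \<longleftrightarrow>
     (\<forall>p. linear_on (tangent_space A p) (\<eta> p)) \<and>
     (\<forall>W X. smooth_vfield A W X \<longrightarrow> smooth_fun A W (\<lambda>p. \<eta> p (X p)))"

definition smooth_tensor11 ::
  "('m::topological_space, 'e::euclidean_space) chart set \<Rightarrow> 'm tensor11 \<Rightarrow> bool" where
  "smooth_tensor11 A \<phi> \<longleftrightarrow>
     (\<forall>p. endomorphism_on (tangent_space A p) (\<phi> p)) \<and>
     (\<forall>W X. smooth_vfield A W X \<longrightarrow> smooth_vfield A W (\<lambda>p. \<phi> p (X p)))"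

definition semi_riemannian_metric ::
  "('m::topological_space, 'e::euclidean_space) chart set \<Rightarrow> 'm form2 \<Rightarrow> bool" where
  "semi_riemannian_metric A g \<longleftrightarrow>
     (\<forall>p. \<forall>v\<in>tangent_space A p. linear_on (tangent_space A p) (g p v)) \<and>
     (\<forall>p. \<forall>v\<in>tangent_space A p. \<forall>w\<in>tangent_space A p. g p v w = g p w v) \<and>
     (\<forall>p. \<forall>v\<in>tangent_space A p. (\<forall>w\<in>tangent_space A p. g p v w = 0) \<longrightarrow> v = 0) \<and>
     (\<forall>W X Y. smooth_vfield A W X \<and> smooth_vfield A W Y \<longrightarrow>
        smooth_fun A W (\<lambda>p. g p (X p) (Y p)))"

text \<open>Exterior derivative and wedge product are normalised as in Kobayashi--Nomizu, i.e.
  \<open>2 d\<eta>(X,Y) = X \<eta>(Y) - Y \<eta>(X) - \<eta>([X,Y])\<close>; this produces the factors \<open>1/2\<close> and \<open>1/3\<close>.\<close>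

definition ext_deriv1 ::
  "('m::topological_space, 'e::euclidean_space) chart set \<Rightarrow> 'm form1 \<Rightarrow>
     'm vfield \<Rightarrow> 'm vfield \<Rightarrow> 'm \<Rightarrow> real" where
  "ext_deriv1 A \<eta> X Y p =
     (X p (\<lambda>q. \<eta> q (Y q)) - Y p (\<lambda>q. \<eta> q (X q)) - \<eta> p (lie_bracket A X Y p)) / 2"

definition ext_deriv2 ::
  "('m::topological_space, 'e::euclidean_space) chart set \<Rightarrow> 'm form2 \<Rightarrow>
     'm vfield \<Rightarrow> 'm vfield \<Rightarrow> 'm vfield \<Rightarrow> 'm \<Rightarrow> real" where
  "ext_deriv2 A \<Phi> X Y Z p =
     (X p (\<lambda>q. \<Phi> q (Y q) (Z q)) + Y p (\<lambda>q. \<Phi> q (Z q) (X q)) + Z p (\<lambda>q. \<Phi> q (X q) (Y q))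
      - \<Phi> p (lie_bracket A X Y p) (Z p) - \<Phi> p (lie_bracket A Y Z p) (X p)
      - \<Phi> p (lie_bracket A Z X p) (Y p)) / 3"

definition wedge12 :: "'m form1 \<Rightarrow> 'm form2 \<Rightarrow> 'm \<Rightarrow> 'm tvec \<Rightarrow> 'm tvec \<Rightarrow> 'm tvec \<Rightarrow> real" where
  "wedge12 \<eta> \<Phi> p u v w = (\<eta> p u * \<Phi> p v w + \<eta> p v * \<Phi> p w u + \<eta> p w * \<Phi> p u v) / 3"

definition nijenhuis ::
  "('m::topological_space, 'e::euclidean_space) chart set \<Rightarrow> 'm tensor11 \<Rightarrow>
     'm vfield \<Rightarrow> 'm vfield \<Rightarrow> 'm vfield" where
  "nijenhuis A \<phi> X Y p =
     \<phi> p (\<phi> p (lie_bracket A X Y p)) + lie_bracket A (\<lambda>q. \<phi> q (X q)) (\<lambda>q. \<phi> q (Y q)) p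
     - \<phi> p (lie_bracket A (\<lambda>q. \<phi> q (X q)) Y p) - \<phi> p (lie_bracket A X (\<lambda>q. \<phi> q (Y q)) p)"

definition lie_deriv_metric ::
  "('m::topological_space, 'e::euclidean_space) chart set \<Rightarrow> 'm vfield \<Rightarrow> 'm form2 \<Rightarrow>
     'm vfield \<Rightarrow> 'm vfield \<Rightarrow> 'm \<Rightarrow> real" where
  "lie_deriv_metric A Z g X Y p =
     Z p (\<lambda>q. g q (X q) (Y q))
     - g p (lie_bracket A Z X p) (Y p) - g p (X p) (lie_bracket A Z Y p)"

section \<open>Levi-Civita connection and curvature\<close>

text \<open>A connection acts on the vector fields of every open set \<open>W\<close>, compatibly with
  restriction (the second conjunct).\<close>

definition affine_connection ::
  "('m::topological_space, 'e::euclidean_space) chart set \<Rightarrow>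
     ('m vfield \<Rightarrow> 'm vfield \<Rightarrow> 'm vfield) \<Rightarrow> bool" where
  "affine_connection A D \<longleftrightarrow>
     (\<forall>W X Y. smooth_vfield A W X \<and> smooth_vfield A W Y \<longrightarrow> smooth_vfield A W (D X Y)) \<and>
     (\<forall>W X Y X' Y'. smooth_vfield A W X \<and> smooth_vfield A W Y \<and>
        (\<forall>p\<in>W. X' p = X p \<and> Y' p = Y p) \<longrightarrow> (\<forall>p\<in>W. D X' Y' p = D X Y p)) \<and>
     (\<forall>W X Y Z f. smooth_vfield A W X \<and> smooth_vfield A W Y \<and> smooth_vfield A W Z \<and>
        smooth_fun A W f \<longrightarrow>
        (\<forall>p\<in>W.
          D (\<lambda>q. X q + Y q) Z p = D X Z p + D Y Z p \<and>
          D (\<lambda>q. f q *\<^sub>f X q) Z p = f p *\<^sub>f D X Z p \<and>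
          D X (\<lambda>q. Y q + Z q) p = D X Y p + D X Z p \<and>
          D X (\<lambda>q. f q *\<^sub>f Y q) p = f p *\<^sub>f D X Y p + X p f *\<^sub>f Y p))"

definition levi_civita ::
  "('m::topological_space, 'e::euclidean_space) chart set \<Rightarrow> 'm form2 \<Rightarrow>
     ('m vfield \<Rightarrow> 'm vfield \<Rightarrow> 'm vfield) \<Rightarrow> bool" where
  "levi_civita A g D \<longleftrightarrow>
     affine_connection A D \<and>
     (\<forall>W X Y. smooth_vfield A W X \<and> smooth_vfield A W Y \<longrightarrow>
        (\<forall>p\<in>W. D X Y p - D Y X p = lie_bracket A X Y p)) \<and>
     (\<forall>W X Y Z. smooth_vfield A W X \<and> smooth_vfield A W Y \<and> smooth_vfield A W Z \<longrightarrow>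
        (\<forall>p\<in>W. X p (\<lambda>q. g q (Y q) (Z q)) = g p (D X Y p) (Z p) + g p (Y p) (D X Z p)))"

definition curvature ::
  "('m::topological_space, 'e::euclidean_space) chart set \<Rightarrow>
     ('m vfield \<Rightarrow> 'm vfield \<Rightarrow> 'm vfield) \<Rightarrow> 'm vfield \<Rightarrow> 'm vfield \<Rightarrow> 'm vfield \<Rightarrow> 'm vfield"
  where
  "curvature A D X Y Z p = D X (D Y Z) p - D Y (D X Z) p - D (lie_bracket A X Y) Z p"

text \<open>By tensoriality the value of \<open>R(X,Y)Z\<close> at \<open>p\<close> depends only on the values of \<open>X\<close>, \<open>Y\<close>, \<open>Z\<close>
  at \<open>p\<close>, hence \<open>R\<close> can be evaluated on tangent vectors.\<close>

definition curvature_at ::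
  "('m::topological_space, 'e::euclidean_space) chart set \<Rightarrow>
     ('m vfield \<Rightarrow> 'm vfield \<Rightarrow> 'm vfield) \<Rightarrow> 'm \<Rightarrow> 'm tvec \<Rightarrow> 'm tvec \<Rightarrow> 'm tvec \<Rightarrow> 'm tvec"
  where
  "curvature_at A D p u v w =
     (THE z. \<forall>W X Y Z. p \<in> W \<and> smooth_vfield A W X \<and> smooth_vfield A W Y \<and> smooth_vfield A W Z \<and>
        X p = u \<and> Y p = v \<and> Z p = w \<longrightarrow> curvature A D X Y Z p = z)"

definition ricci ::
  "('m::topological_space, 'e::euclidean_space) chart set \<Rightarrow>
     ('m vfield \<Rightarrow> 'm vfield \<Rightarrow> 'm vfield) \<Rightarrow> 'm form2" where
  "ricci A D p v w = trace_on (tangent_space A p) (\<lambda>u. curvature_at A D p u v w)"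

definition ricci_operator ::
  "('m::topological_space, 'e::euclidean_space) chart set \<Rightarrow> 'm form2 \<Rightarrow>
     ('m vfield \<Rightarrow> 'm vfield \<Rightarrow> 'm vfield) \<Rightarrow> 'm tensor11" where
  "ricci_operator A g D p v =
     (THE w. w \<in> tangent_space A p \<and> (\<forall>u\<in>tangent_space A p. g p w u = ricci A D p v u))"

definition scalar_curvature ::
  "('m::topological_space, 'e::euclidean_space) chart set \<Rightarrow> 'm form2 \<Rightarrow>
     ('m vfield \<Rightarrow> 'm vfield \<Rightarrow> 'm vfield) \<Rightarrow> 'm \<Rightarrow> real" where
  "scalar_curvature A g D p = trace_on (tangent_space A p) (ricci_operator A g D p)"

section \<open>Para-Kenmotsu manifolds and solitons\<close>

definition almost_paracontact_metric ::
  "nat \<Rightarrow> ('m::topological_space, 'e::euclidean_space) chart set \<Rightarrow>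
     'm tensor11 \<Rightarrow> 'm vfield \<Rightarrow> 'm form1 \<Rightarrow> 'm form2 \<Rightarrow> bool" where
  "almost_paracontact_metric n A \<phi> \<zeta> \<eta> g \<longleftrightarrow>
     smooth_tensor11 A \<phi> \<and> smooth_vfield A UNIV \<zeta> \<and> smooth_form1 A \<eta> \<and>
     semi_riemannian_metric A g \<and>
     (\<forall>p. \<forall>v\<in>tangent_space A p. \<phi> p (\<phi> p v) = v - \<eta> p v *\<^sub>f \<zeta> p) \<and>
     (\<forall>p. \<eta> p (\<zeta> p) = 1) \<and>
     (\<forall>p. fun_space.dim {v \<in> tangent_space A p. \<eta> p v = 0 \<and> \<phi> p v = v} = n) \<and>
     (\<forall>p. fun_space.dim {v \<in> tangent_space A p. \<eta> p v = 0 \<and> \<phi> p v = - v} = n) \<and>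
     (\<forall>p. \<forall>v\<in>tangent_space A p. \<forall>w\<in>tangent_space A p.
        g p (\<phi> p v) (\<phi> p w) = - g p v w + \<eta> p v * \<eta> p w)"

definition fundamental_form :: "'m tensor11 \<Rightarrow> 'm form2 \<Rightarrow> 'm form2" where
  "fundamental_form \<phi> g p v w = g p v (\<phi> p w)"

definition normal_structure ::
  "('m::topological_space, 'e::euclidean_space) chart set \<Rightarrow>
     'm tensor11 \<Rightarrow> 'm vfield \<Rightarrow> 'm form1 \<Rightarrow> bool" where
  "normal_structure A \<phi> \<zeta> \<eta> \<longleftrightarrow>
     (\<forall>W X Y. smooth_vfield A W X \<and> smooth_vfield A W Y \<longrightarrow>
        (\<forall>p\<in>W. nijenhuis A \<phi> X Y p - (2 * ext_deriv1 A \<eta> X Y p) *\<^sub>f \<zeta> p = 0))"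

definition para_kenmotsu ::
  "nat \<Rightarrow> ('m::topological_space, 'e::euclidean_space) chart set \<Rightarrow>
     'm tensor11 \<Rightarrow> 'm vfield \<Rightarrow> 'm form1 \<Rightarrow> 'm form2 \<Rightarrow> bool" where
  "para_kenmotsu n A \<phi> \<zeta> \<eta> g \<longleftrightarrow>
     almost_paracontact_metric n A \<phi> \<zeta> \<eta> g \<and>
     normal_structure A \<phi> \<zeta> \<eta> \<and>
     (\<forall>W X Y. smooth_vfield A W X \<and> smooth_vfield A W Y \<longrightarrow>
        (\<forall>p\<in>W. ext_deriv1 A \<eta> X Y p = 0)) \<and>
     (\<forall>W X Y Z. smooth_vfield A W X \<and> smooth_vfield A W Y \<and> smooth_vfield A W Z \<longrightarrow>
        (\<forall>p\<in>W. ext_deriv2 A (fundamental_form \<phi> g) X Y Z p =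
                2 * wedge12 \<eta> (fundamental_form \<phi> g) p (X p) (Y p) (Z p)))"

text \<open>The soliton with soliton vector field \<open>V\<close>; \<open>D\<close> is the Levi-Civita connection of \<open>g\<close>.\<close>

definition h_almost_ricci_yamabe_soliton ::
  "('m::topological_space, 'e::euclidean_space) chart set \<Rightarrow> 'm form2 \<Rightarrow>
     ('m vfield \<Rightarrow> 'm vfield \<Rightarrow> 'm vfield) \<Rightarrow> ('m \<Rightarrow> real) \<Rightarrow> 'm vfield \<Rightarrow>
     ('m \<Rightarrow> real) \<Rightarrow> real \<Rightarrow> real \<Rightarrow> bool" where
  "h_almost_ricci_yamabe_soliton A g D h V l \<alpha> \<beta> \<longleftrightarrow>
     smooth_fun A UNIV h \<and> smooth_fun A UNIV l \<and> smooth_vfield A UNIV V \<and>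
     (\<forall>W X Y. smooth_vfield A W X \<and> smooth_vfield A W Y \<longrightarrow>
        (\<forall>p\<in>W. h p / 2 * lie_deriv_metric A V g X Y p + \<alpha> * ricci A D p (X p) (Y p)
                + (l p - \<beta> / 2 * scalar_curvature A g D p) * g p (X p) (Y p) = 0))"

definition eta_einstein ::
  "('m::topological_space, 'e::euclidean_space) chart set \<Rightarrow> 'm form1 \<Rightarrow> 'm form2 \<Rightarrow>
     ('m vfield \<Rightarrow> 'm vfield \<Rightarrow> 'm vfield) \<Rightarrow> bool" where
  "eta_einstein A \<eta> g D \<longleftrightarrow>
     (\<exists>a b. smooth_fun A UNIV a \<and> smooth_fun A UNIV b \<and>
        (\<forall>p. \<forall>v\<in>tangent_space A p. \<forall>w\<in>tangent_space A p.
           ricci A D p v w = a p * g p v w + b p * (\<eta> p v * \<eta> p w)))"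

end

theory Submission
  imports Defs
begin

text \<open>
  Normality evaluated on \<open>(X, \<zeta>)\<close> gives \<open>\<pounds>\<^sub>\<zeta> \<phi> = 0\<close>, and \<open>d\<Phi> = 2 \<eta> \<and> \<Phi>\<close> contracted with \<open>\<zeta>\<close> gives
  \<open>\<pounds>\<^sub>\<zeta> \<Phi> = 2 \<Phi>\<close>; together with \<open>d\<eta> = 0\<close> these yield \<open>\<nabla>\<^sub>X \<zeta> = X - \<eta>(X) \<zeta>\<close>, hence
  \<open>\<pounds>\<^sub>\<zeta> g = 2 (g - \<eta> \<otimes> \<eta>)\<close>.  The soliton equation then reads
  \<open>\<alpha> S = - (h + s) g + h \<eta> \<otimes> \<eta>\<close> with \<open>s = \<lambda> - \<beta> r / 2\<close>.  Since
  \<open>R(X, \<zeta>)\<zeta> = \<eta>(X) \<zeta> - X\<close> has trace \<open>-2n\<close>, evaluating the equation on \<open>(\<zeta>, \<zeta>)\<close> gives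
  \<open>s = 2n \<alpha>\<close>, so both coefficients are smooth.
\<close>

section \<open>Calculus of functions of class \<open>C\<^sup>k\<close>\<close>

text \<open>The scalar curvature enters only through s, which turns out to be the same constant at
  every point. The smoothness of both coefficients therefore rests on that of h alone, and r never
  has to be shown smooth. Two encodings shape the rest. \<open>curvature_at\<close> is a definite
  description over all local extensions of three tangent vectors, so the computed value of R(X,
  \<zeta>)\<zeta> counts only once tensoriality in the second and third slots is known; in the first
  slot it is visible in the formula. \<open>trace_on\<close> picks an unspecified basis, so the
  trace requires the cardinality of every basis of a tangent space. Both points rest on coordinate
  frames, hence on the chain rule between charts. Brackets of smooth fields are controlled through
  the torsion-free connection instead of the symmetry of second derivatives.\<close>

lemma ck_on_subset: "ck_on k S f \<Longrightarrow> T \<subseteq> S \<Longrightarrow> ck_on k T f"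
  by (induction k arbitrary: f) (auto intro: continuous_on_subset)

text \<open>Functions are total and their values off S are irrelevant. Since S is open, derivatives
  of every order at points of S see only the values on S.\<close>

lemma ck_on_cong:
  assumes "open S" "\<And>x. x \<in> S \<Longrightarrow> f x = g x" "ck_on k S f"
  shows "ck_on k S g"
  using assms(2,3)
proof (induction k arbitrary: f g)
  case 0
  then show ?case by (metis ck_on.simps(1) continuous_on_cong)
next
  case (Suc k)
  have deriv: "(g has_derivative frechet_derivative f (at x)) (at x)" if "x \<in> S" for x
    by (rule has_derivative_transform_within_open[of f _ x UNIV S])
      (use Suc.prems that \<open>open S\<close> in \<open>auto simp: frechet_derivative_works\<close>)
  have eq: "frechet_derivative f (at x) = frechet_derivative g (at x)" if "x \<in> S" for x
    using frechet_derivative_at[OF deriv[OF that]] .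
  have "ck_on k S (\<lambda>x. frechet_derivative g (at x) v)" for v
    by (rule Suc.IH[of "\<lambda>x. frechet_derivative f (at x) v"]) (use eq Suc.prems(2) in simp_all)
  moreover have "g differentiable (at x)" if "x \<in> S" for x
    using deriv[OF that] by (rule differentiableI)
  ultimately show ?case by simp
qed

lemma ck_on_SucD:
  assumes "ck_on (Suc k) S f"
  shows "ck_on k S f"
  using assms
proof (induction k arbitrary: f)
  case 0
  then show ?case
    by (simp add: continuous_at_imp_continuous_on differentiable_imp_continuous_within)
next
  case (Suc k)
  show ?case unfolding ck_on.simps(2)[of k]
    using Suc.prems Suc.IH[of "\<lambda>x. frechet_derivative f (at x) v" for v] by simp
qed

text \<open>Lets an explicitly known derivative stand in for \<open>frechet_derivative\<close>; the
  inductions for sums, products and compositions all close with this rule.\<close>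

lemma ck_on_SucI:
  assumes "open S" "\<And>x. x \<in> S \<Longrightarrow> (f has_derivative f' x) (at x)"
    and "\<And>v. ck_on k S (\<lambda>x. f' x v)"
  shows "ck_on (Suc k) S f"
proof -
  have eq: "f' x = frechet_derivative f (at x)" if "x \<in> S" for x
    using frechet_derivative_at[OF assms(2)[OF that]] .
  have "ck_on k S (\<lambda>x. frechet_derivative f (at x) v)" for v
    by (rule ck_on_cong[OF assms(1) _ assms(3)[of v]]) (simp add: eq)
  moreover have "f differentiable (at x)" if "x \<in> S" for x
    using assms(2)[OF that] by (rule differentiableI)
  ultimately show ?thesis by simp
qed

lemma ck_on_const: "open S \<Longrightarrow> ck_on k S (\<lambda>x. c)"
proof (induction k arbitrary: c)
  case (Suc k)
  show ?case
    by (rule ck_on_SucI[OF Suc.prems has_derivative_const Suc.IH[OF Suc.prems]])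
qed simp

lemma ck_on_has_derivative:
  "ck_on (Suc k) S f \<Longrightarrow> x \<in> S \<Longrightarrow> (f has_derivative frechet_derivative f (at x)) (at x)"
  by (simp add: frechet_derivative_works)

lemma ck_on_add:
  assumes "open S" "ck_on k S f" "ck_on k S g"
  shows "ck_on k S (\<lambda>x. f x + g x)"
  using assms(2,3)
proof (induction k arbitrary: f g)
  case (Suc k)
  have "ck_on k S (\<lambda>x. frechet_derivative f (at x) v + frechet_derivative g (at x) v)" for v
    using Suc by simp
  then show ?case
    by (intro ck_on_SucI[OF assms(1) has_derivative_add[OF
            ck_on_has_derivative[OF Suc.prems(1)] ck_on_has_derivative[OF Suc.prems(2)]]])
qed (simp add: continuous_on_add)

lemma ck_on_bilinear:
  assumes "bounded_bilinear B" "open S" "ck_on k S f" "ck_on k S g"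
  shows "ck_on k S (\<lambda>x. B (f x) (g x))"
  using assms(3,4)
proof (induction k arbitrary: f g)
  case 0
  then show ?case by (simp add: bounded_bilinear.continuous_on[OF assms(1)])
next
  case (Suc k)
  \<comment> \<open>The product rule leaves one factor undifferentiated, whose class must be lowered
    to \<open>k\<close> before the induction hypothesis applies.\<close>
  have "ck_on k S f" "ck_on k S g"
    using ck_on_SucD[OF Suc.prems(1)] ck_on_SucD[OF Suc.prems(2)] .
  moreover have "ck_on k S (\<lambda>x. frechet_derivative f (at x) v)"
    "ck_on k S (\<lambda>x. frechet_derivative g (at x) v)" for v
    using Suc.prems by simp_all
  ultimately have "ck_on k S (\<lambda>x. B (f x) (frechet_derivative g (at x) v) +
      B (frechet_derivative f (at x) v) (g x))" for v
    by (intro ck_on_add assms(2) Suc.IH)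
  then show ?case
    by (intro ck_on_SucI[OF assms(2) bounded_bilinear.FDERIV[OF assms(1)
            ck_on_has_derivative[OF Suc.prems(1)] ck_on_has_derivative[OF Suc.prems(2)]]])
qed

lemma ck_on_sum:
  assumes "open S" "finite I" "\<And>i. i \<in> I \<Longrightarrow> ck_on k S (f i)"
  shows "ck_on k S (\<lambda>x. \<Sum>i\<in>I. f i x)"
  using assms(2,3)
  by (induction rule: finite_induct) (simp_all add: ck_on_const ck_on_add assms(1))

lemma ck_on_compose:
  fixes g :: "'a::euclidean_space \<Rightarrow> 'b::euclidean_space" and f :: "'b \<Rightarrow> 'c::real_normed_vector"
  assumes "open S" "g ` S \<subseteq> T" "ck_on k T f" "ck_on k S g"
  shows "ck_on k S (\<lambda>x. f (g x))"
  using assms(3,4)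
proof (induction k arbitrary: f)
  case 0
  then show ?case using assms(2) by (simp add: continuous_on_compose2[of T f S g])
next
  case (Suc k)
  let ?Df = "\<lambda>y. frechet_derivative f (at y)" and ?Dg = "\<lambda>x. frechet_derivative g (at x)"
  \<comment> \<open>\<open>ck_on\<close> differentiates in fixed directions only, whereas the chain
    rule evaluates \<open>?Df (g x)\<close> in the direction \<open>?Dg x v\<close>, which varies
    with \<open>x\<close>. Expanding in \<open>Basis\<close> moves this dependence into scalar
    coefficients.\<close>
  have "((\<lambda>x. f (g x)) has_derivative (\<lambda>v. \<Sum>b\<in>Basis. (?Dg x v \<bullet> b) *\<^sub>R ?Df (g x) b)) (at x)"
    if "x \<in> S" for x
  proof -
    have f': "(f has_derivative ?Df (g x)) (at (g x))"
      using ck_on_has_derivative[OF Suc.prems(1)] assms(2) that by blast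
    have "((\<lambda>x. f (g x)) has_derivative (\<lambda>v. ?Df (g x) (?Dg x v))) (at x)"
      using has_derivative_compose[OF ck_on_has_derivative[OF Suc.prems(2) that] f'] .
    moreover have "?Df (g x) w = (\<Sum>b\<in>Basis. (w \<bullet> b) *\<^sub>R ?Df (g x) b)" for w
    proof -
      have "?Df (g x) w = ?Df (g x) (\<Sum>b\<in>Basis. (w \<bullet> b) *\<^sub>R b)"
        by (simp only: euclidean_representation)
      then show ?thesis
        by (simp only: linear_sum[OF has_derivative_linear[OF f']]
            linear_scale[OF has_derivative_linear[OF f']])
    qed
    ultimately show ?thesis by (rule has_derivative_eq_rhs[OF _ ext])
  qed
  moreover have "ck_on k S (\<lambda>x. \<Sum>b\<in>Basis. (?Dg x v \<bullet> b) *\<^sub>R ?Df (g x) b)" for v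
  proof (intro ck_on_sum ck_on_bilinear[OF bounded_bilinear_scaleR] ck_on_bilinear[OF bounded_bilinear_inner]
      ck_on_const assms(1) finite_Basis)
    show "ck_on k S (\<lambda>x. ?Dg x v)" using Suc.prems(2) by simp
    show "ck_on k S (\<lambda>x. ?Df (g x) b)" for b
      using Suc.IH[of "\<lambda>y. ?Df y b"] Suc.prems(1) ck_on_SucD[OF Suc.prems(2)] by simp
  qed
  ultimately show ?case by (rule ck_on_SucI[OF assms(1)])
qed

section \<open>Charts, tangent vectors and vector fields\<close>

lemma smooth_on_subset: "smooth_on S f \<Longrightarrow> T \<subseteq> S \<Longrightarrow> smooth_on T f"
  unfolding smooth_on_def using ck_on_subset by blast

lemma smooth_on_cong:
  "open S \<Longrightarrow> (\<And>x. x \<in> S \<Longrightarrow> f x = g x) \<Longrightarrow> smooth_on S f \<Longrightarrow> smooth_on S g"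
  unfolding smooth_on_def using ck_on_cong[of S f g] by simp

lemma smooth_on_const: "open S \<Longrightarrow> smooth_on S (\<lambda>x. c)"
  unfolding smooth_on_def by (simp add: ck_on_const)

lemma smooth_on_add: "open S \<Longrightarrow> smooth_on S f \<Longrightarrow> smooth_on S g \<Longrightarrow> smooth_on S (\<lambda>x. f x + g x)"
  unfolding smooth_on_def by (simp add: ck_on_add)

lemma smooth_on_bilinear:
  "bounded_bilinear B \<Longrightarrow> open S \<Longrightarrow> smooth_on S f \<Longrightarrow> smooth_on S g \<Longrightarrow> smooth_on S (\<lambda>x. B (f x) (g x))"
  unfolding smooth_on_def using ck_on_bilinear[of B S _ f g] by simp

lemma smooth_on_compose:
  fixes g :: "'a::euclidean_space \<Rightarrow> 'b::euclidean_space"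
  shows "open S \<Longrightarrow> g ` S \<subseteq> T \<Longrightarrow> smooth_on T f \<Longrightarrow> smooth_on S g \<Longrightarrow> smooth_on S (\<lambda>x. f (g x))"
  unfolding smooth_on_def using ck_on_compose[of S g T _ f] by simp

lemma smooth_on_imp_has_derivative:
  "smooth_on S f \<Longrightarrow> x \<in> S \<Longrightarrow> (f has_derivative frechet_derivative f (at x)) (at x)"
  unfolding smooth_on_def by (blast intro: ck_on_has_derivative)

lemma smooth_on_directional_derivative:
  assumes "smooth_on S f"
  shows "smooth_on S (\<lambda>x. frechet_derivative f (at x) v)"
  unfolding smooth_on_def
proof
  fix k
  have "ck_on (Suc k) S f" using assms unfolding smooth_on_def by blast
  then show "ck_on k S (\<lambda>x. frechet_derivative f (at x) v)" by simp
qed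

lemma linear_onD:
  assumes "linear_on V F"
  shows "v \<in> V \<Longrightarrow> w \<in> V \<Longrightarrow> F (v + w) = F v + F w" "v \<in> V \<Longrightarrow> F (c *\<^sub>f v) = c * F v"
  using assms unfolding linear_on_def by auto

section \<open>Charts and smooth functions on the manifold\<close>

locale smooth_manifold =
  fixes A :: "('m::{second_countable_topology, t2_space}, 'e::euclidean_space) chart set"
  assumes atlas: "smooth_atlas A"
begin

lemma chart_exists: obtains U c where "(U, c) \<in> A" "p \<in> U"
proof -
  have "p \<in> (\<Union>(U, c)\<in>A. U)" using atlas unfolding smooth_atlas_def by simp
  then show thesis using that by auto
qed

lemma chart_open: "(U, c) \<in> A \<Longrightarrow> open U"
  and chart_homeomorphism: "(U, c) \<in> A \<Longrightarrow> homeomorphism U (c ` U) c (inv_into U c)"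
  and chart_image_open': "(U, c) \<in> A \<Longrightarrow> open (c ` U)"
  and transition_smooth:
    "(U, c) \<in> A \<Longrightarrow> (V, d) \<in> A \<Longrightarrow> smooth_on (c ` (U \<inter> V)) (d \<circ> inv_into U c)"
  using atlas unfolding smooth_atlas_def by (force+)

lemma chart_inv: "(U, c) \<in> A \<Longrightarrow> q \<in> U \<Longrightarrow> inv_into U c (c q) = q"
  using chart_homeomorphism[of U c] unfolding homeomorphism_def by blast

lemma chart_image_open:
  assumes "(U, c) \<in> A" "open W"
  shows "open (c ` (U \<inter> W))"
proof -
  have "openin (top_of_set (c ` U)) (c ` (U \<inter> W))"
    using homeomorphism_imp_open_map[OF chart_homeomorphism[OF assms(1)]] assms(2)
    by (simp add: openin_open_Int)
  then show ?thesis
    using chart_image_open'[OF assms(1)] openin_open_eq by blast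
qed

lemma smooth_funD:
  "smooth_fun A W f \<Longrightarrow> (U, c) \<in> A \<Longrightarrow> smooth_on (c ` (U \<inter> W)) (f \<circ> inv_into U c)"
  unfolding smooth_fun_def by blast

text \<open>\<open>smooth_fun\<close> tests against every chart; composing with the smooth
  transition maps reduces this to a single one.\<close>

lemma smooth_funI:
  assumes "(U, c) \<in> A" "open W" "W \<subseteq> U" "smooth_on (c ` W) (f \<circ> inv_into U c)"
  shows "smooth_fun A W f"
proof -
  have "smooth_on (d ` (V \<inter> W)) (f \<circ> inv_into V d)" if "(V, d) \<in> A" for V d
  proof -
    have o: "open (d ` (V \<inter> W))" using chart_image_open that assms(2) by blast
    have s: "smooth_on (d ` (V \<inter> W)) (c \<circ> inv_into V d)"
      using transition_smooth[OF that assms(1)] assms(3) by (auto elim!: smooth_on_subset)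
    have im: "(c \<circ> inv_into V d) ` (d ` (V \<inter> W)) \<subseteq> c ` W"
      using chart_inv[OF that] by auto
    have "smooth_on (d ` (V \<inter> W)) (\<lambda>x. (f \<circ> inv_into U c) ((c \<circ> inv_into V d) x))"
      using smooth_on_compose[OF o im assms(4) s] .
    then show ?thesis
      by (rule smooth_on_cong[OF o, rotated])
        (use chart_inv[OF that] chart_inv[OF assms(1)] assms(3) in auto)
  qed
  then show ?thesis unfolding smooth_fun_def by blast
qed

lemma smooth_fun_subset:
  assumes "smooth_fun A W f" "V \<subseteq> W"
  shows "smooth_fun A V f"
  unfolding smooth_fun_def
proof clarify
  fix U c assume "(U, c) \<in> A"
  moreover have "c ` (U \<inter> V) \<subseteq> c ` (U \<inter> W)" using assms(2) by blast
  ultimately show "smooth_on (c ` (U \<inter> V)) (f \<circ> inv_into U c)"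
    using smooth_funD[OF assms(1)] smooth_on_subset by blast
qed

lemma smooth_fun_cong:
  assumes "open W" "\<And>q. q \<in> W \<Longrightarrow> f q = g q" "smooth_fun A W f"
  shows "smooth_fun A W g"
  unfolding smooth_fun_def
proof clarify
  fix U c assume U: "(U, c) \<in> A"
  show "smooth_on (c ` (U \<inter> W)) (g \<circ> inv_into U c)"
    by (rule smooth_on_cong[OF chart_image_open[OF U assms(1)] _ smooth_funD[OF assms(3) U]])
      (use assms(2) chart_inv[OF U] in auto)
qed

lemma smooth_fun_const: "open W \<Longrightarrow> smooth_fun A W (\<lambda>q. k)"
  unfolding smooth_fun_def by (auto simp: comp_def intro!: smooth_on_const chart_image_open)

lemma smooth_fun_add:
  "open W \<Longrightarrow> smooth_fun A W f \<Longrightarrow> smooth_fun A W g \<Longrightarrow> smooth_fun A W (\<lambda>q. f q + g q)"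
  unfolding smooth_fun_def
  by (auto simp: comp_def dest!: bspec intro!: smooth_on_add chart_image_open)

lemma smooth_fun_mult:
  "open W \<Longrightarrow> smooth_fun A W f \<Longrightarrow> smooth_fun A W g \<Longrightarrow> smooth_fun A W (\<lambda>q. f q * g q)"
  unfolding smooth_fun_def
  by (auto simp: comp_def dest!: bspec
      intro!: smooth_on_bilinear[OF bounded_bilinear_mult] chart_image_open)

lemma smooth_near_cong:
  assumes "open W" "p \<in> W" "\<And>q. q \<in> W \<Longrightarrow> f q = g q" "smooth_near A p f"
  shows "smooth_near A p g"
proof -
  obtain V where "open V" "p \<in> V" "smooth_fun A V f"
    using assms(4) unfolding smooth_near_def by blast
  then have "open (V \<inter> W)" "p \<in> V \<inter> W" "smooth_fun A (V \<inter> W) f"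
    using assms smooth_fun_subset by auto
  then show ?thesis
    unfolding smooth_near_def using smooth_fun_cong[of "V \<inter> W" f g] assms(3) by blast
qed

lemma smooth_nearI: "open W \<Longrightarrow> p \<in> W \<Longrightarrow> smooth_fun A W f \<Longrightarrow> smooth_near A p f"
  unfolding smooth_near_def by blast

lemma smooth_near_has_derivative:
  assumes "smooth_near A p f" "(U, c) \<in> A" "p \<in> U"
  shows "(f \<circ> inv_into U c has_derivative frechet_derivative (f \<circ> inv_into U c) (at (c p))) (at (c p))"
proof -
  obtain W where W: "open W" "p \<in> W" "smooth_fun A W f"
    using assms(1) unfolding smooth_near_def by blast
  show ?thesis
    by (rule smooth_on_imp_has_derivative[OF smooth_funD[OF W(3) assms(2)]]) (use W assms in auto)
qed

section \<open>Tangent vectors in coordinates\<close>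

lemma coord_vec_linear:
  assumes "(U, c) \<in> A" "p \<in> U"
  shows "coord_vec A (U, c) p (u + w) = coord_vec A (U, c) p u + coord_vec A (U, c) p w"
    and "coord_vec A (U, c) p (k *\<^sub>R u) = k *\<^sub>f coord_vec A (U, c) p u"
  using has_derivative_linear[OF smooth_near_has_derivative[OF _ assms]]
  by (auto simp: coord_vec_def fun_eq_iff fscale_def linear_add linear_scale)

text \<open>Chain rule for the transition map. \<open>tangent_space\<close> is a union over all
  charts at \<open>p\<close>; this is why any one of them already produces all of it.\<close>

lemma coord_vec_change:
  assumes "(U, c) \<in> A" "(V, d) \<in> A" "p \<in> U" "p \<in> V"
  shows "coord_vec A (V, d) p v =
    coord_vec A (U, c) p (frechet_derivative (c \<circ> inv_into V d) (at (d p)) v)"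
proof -
  let ?t = "c \<circ> inv_into V d"
  have "frechet_derivative (f \<circ> inv_into V d) (at (d p)) v =
      frechet_derivative (f \<circ> inv_into U c) (at (c p)) (frechet_derivative ?t (at (d p)) v)"
    if "smooth_near A p f" for f
  proof -
    have t: "(?t has_derivative frechet_derivative ?t (at (d p))) (at (d p))"
      by (rule smooth_on_imp_has_derivative[OF transition_smooth[OF assms(2,1)]]) (use assms in auto)
    have tp: "?t (d p) = c p" using chart_inv assms by simp
    have "((\<lambda>x. (f \<circ> inv_into U c) (?t x)) has_derivative
        (\<lambda>v. frechet_derivative (f \<circ> inv_into U c) (at (c p)) (frechet_derivative ?t (at (d p)) v))) (at (d p))"
      by (rule has_derivative_compose[OF t]) (unfold tp, rule smooth_near_has_derivative[OF that assms(1,3)])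
    then have "(f \<circ> inv_into V d has_derivative
        (\<lambda>v. frechet_derivative (f \<circ> inv_into U c) (at (c p)) (frechet_derivative ?t (at (d p)) v))) (at (d p))"
      by (rule has_derivative_transform_within_open[OF _ chart_image_open[OF assms(2) chart_open[OF assms(1)]]])
        (use assms chart_inv in auto)
    then show ?thesis by (metis frechet_derivative_at)
  qed
  then show ?thesis by (auto simp: coord_vec_def fun_eq_iff)
qed

lemma tangent_space_eq:
  assumes "(U, c) \<in> A" "p \<in> U"
  shows "tangent_space A p = range (coord_vec A (U, c) p)"
proof
  show "tangent_space A p \<subseteq> range (coord_vec A (U, c) p)"
    unfolding tangent_space_def using coord_vec_change[OF assms(1) _ assms(2)] by auto
  show "range (coord_vec A (U, c) p) \<subseteq> tangent_space A p"
    unfolding tangent_space_def using assms by force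
qed

lemma tangent_space_subspace: "fun_space.subspace (tangent_space A p)"
proof -
  obtain U c where U: "(U, c) \<in> A" "p \<in> U" by (rule chart_exists)
  have "(0 :: 'm tvec) = coord_vec A (U, c) p 0"
    using coord_vec_linear(2)[OF U, of 0 0] by (simp add: fscale_def zero_fun_def)
  then show ?thesis
    unfolding fun_space.subspace_def tangent_space_eq[OF U]
    using coord_vec_linear[OF U, symmetric] by auto
qed

lemmas tangent_space_closed [simp, intro] =
  fun_space.subspace_0[OF tangent_space_subspace] fun_space.subspace_add[OF tangent_space_subspace]
  fun_space.subspace_scale[OF tangent_space_subspace] fun_space.subspace_diff[OF tangent_space_subspace]
  fun_space.subspace_neg[OF tangent_space_subspace]

lemma smooth_coordinate:
  assumes "(U, c) \<in> A"
  shows "smooth_fun A U (\<lambda>q. c q \<bullet> b)"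
proof (rule smooth_funI[OF assms chart_open[OF assms] order_refl])
  \<comment> \<open>The transition of the chart with itself is
    \<open>c \<circ> inv_into U c\<close>, the identity on the chart image.\<close>
  have "smooth_on (c ` U) (\<lambda>x. (c \<circ> inv_into U c) x \<bullet> b)"
    using transition_smooth[OF assms assms] chart_image_open'[OF assms]
    by (intro smooth_on_bilinear[OF bounded_bilinear_inner] smooth_on_const) (simp_all add: comp_def)
  then show "smooth_on (c ` U) ((\<lambda>q. c q \<bullet> b) \<circ> inv_into U c)" by (simp add: comp_def)
qed

lemma coord_vec_coordinate:
  assumes "(U, c) \<in> A" "p \<in> U"
  shows "coord_vec A (U, c) p u (\<lambda>q. c q \<bullet> b) = u \<bullet> b"
proof -
  have "((\<lambda>x. x \<bullet> b) has_derivative (\<lambda>u. u \<bullet> b)) (at (c p))"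
    by (auto intro!: derivative_eq_intros)
  then have "((\<lambda>q. c q \<bullet> b) \<circ> inv_into U c has_derivative (\<lambda>u. u \<bullet> b)) (at (c p))"
    by (rule has_derivative_transform_within_open[OF _ chart_image_open'[OF assms(1)]])
      (use assms chart_inv in auto)
  then have "frechet_derivative ((\<lambda>q. c q \<bullet> b) \<circ> inv_into U c) (at (c p)) = (\<lambda>u. u \<bullet> b)"
    by (metis frechet_derivative_at)
  moreover have "smooth_near A p (\<lambda>q. c q \<bullet> b)"
    using smooth_nearI[OF chart_open[OF assms(1)] assms(2) smooth_coordinate[OF assms(1)]] .
  ultimately show ?thesis by (simp add: coord_vec_def)
qed

text \<open>Valid for arbitrary \<open>f\<close> and \<open>g\<close>: smoothness near
  \<open>p\<close> is itself local, so if one of them falls under the default value 0, so does the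
  other.\<close>

lemma tangent_local:
  assumes "v \<in> tangent_space A p" "open W" "p \<in> W" "\<And>q. q \<in> W \<Longrightarrow> f q = g q"
  shows "v f = v g"
proof -
  obtain U c where U: "(U, c) \<in> A" "p \<in> U" by (rule chart_exists)
  obtain u where v: "v = coord_vec A (U, c) p u" using assms(1) tangent_space_eq[OF U] by auto
  have "smooth_near A p f \<longleftrightarrow> smooth_near A p g"
    using smooth_near_cong[OF assms(2,3)] assms(4) by metis
  moreover have "frechet_derivative (f \<circ> inv_into U c) (at (c p)) =
      frechet_derivative (g \<circ> inv_into U c) (at (c p))" if "smooth_near A p f"
    by (rule frechet_derivative_at, rule has_derivative_transform_within_open[OF
          smooth_near_has_derivative[OF that U] chart_image_open[OF U(1) assms(2)]])
      (use U assms chart_inv in auto)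
  ultimately show ?thesis unfolding v by (simp add: coord_vec_def)
qed

lemma tangent_const:
  assumes "v \<in> tangent_space A p"
  shows "v (\<lambda>q. k) = 0"
proof -
  obtain U c where U: "(U, c) \<in> A" "p \<in> U" by (rule chart_exists)
  then show ?thesis
    using assms tangent_space_eq[OF U] by (auto simp: coord_vec_def comp_def)
qed

lemma tangent_locally_const:
  assumes "v \<in> tangent_space A p" "open W" "p \<in> W" "\<And>q. q \<in> W \<Longrightarrow> f q = k"
  shows "v f = 0"
  using tangent_local[OF assms] tangent_const[OF assms(1)] by simp

lemma coord_vec_expand:
  assumes "(U, c) \<in> A" "p \<in> U"
  shows "coord_vec A (U, c) p u = (\<Sum>b\<in>Basis. (u \<bullet> b) *\<^sub>f coord_vec A (U, c) p b)"
proof -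
  have "coord_vec A (U, c) p (\<Sum>b\<in>I. (u \<bullet> b) *\<^sub>R b) = (\<Sum>b\<in>I. (u \<bullet> b) *\<^sub>f coord_vec A (U, c) p b)"
    if "finite I" for I
    using that
  proof (induction rule: finite_induct)
    case empty
    show ?case using coord_vec_linear(2)[OF assms, of 0 0] by (simp add: fscale_def zero_fun_def)
  qed (simp add: coord_vec_linear[OF assms])
  from this[OF finite_Basis] show ?thesis by (simp only: euclidean_representation)
qed

lemma tangent_expand:
  assumes "(U, c) \<in> A" "p \<in> U" "v \<in> tangent_space A p"
  shows "v = (\<Sum>b\<in>Basis. v (\<lambda>q. c q \<bullet> b) *\<^sub>f coord_vec A (U, c) p b)"
proof -
  obtain u where v: "v = coord_vec A (U, c) p u" using assms(3) tangent_space_eq[OF assms(1,2)] by auto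
  then have "u \<bullet> b = v (\<lambda>q. c q \<bullet> b)" for b
    using coord_vec_coordinate[OF assms(1,2)] by simp
  with v coord_vec_expand[OF assms(1,2), of u] show ?thesis by simp
qed

text \<open>Serves the trace of the identity, which is the size of whatever basis
  \<open>trace_on\<close> selects. The coordinate vectors form one basis, and the exchange bound
  used in both directions transfers their number to \<open>B\<close>.\<close>

lemma tangent_basis_card:
  assumes "fun_space.independent B" "fun_space.span B = tangent_space A p"
  shows "finite B" "card B = DIM('e)"
proof -
  obtain U c where U: "(U, c) \<in> A" "p \<in> U" by (rule chart_exists)
  let ?E = "coord_vec A (U, c) p"
  have inj: "inj ?E"
  proof
    fix u w assume "?E u = ?E w"
    then have "u \<bullet> b = w \<bullet> b" for b using coord_vec_coordinate[OF U] by metis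
    then show "u = w" by (rule euclidean_eqI)
  qed
  have fin: "finite (?E ` Basis)" by simp
  have card: "card (?E ` Basis) = DIM('e)"
    using inj by (simp add: card_image inj_on_subset)
  have TE: "tangent_space A p \<subseteq> fun_space.span (?E ` Basis)"
  proof
    fix v assume "v \<in> tangent_space A p"
    then have "v = (\<Sum>b\<in>Basis. v (\<lambda>q. c q \<bullet> b) *\<^sub>f ?E b)" by (rule tangent_expand[OF U])
    also have "\<dots> \<in> fun_space.span (?E ` Basis)"
      by (intro fun_space.span_sum fun_space.span_scale fun_space.span_base imageI)
    finally show "v \<in> fun_space.span (?E ` Basis)" .
  qed
  have ET: "?E ` Basis \<subseteq> tangent_space A p"
    using tangent_space_eq[OF U] by auto
  \<comment> \<open>Applying the vanishing combination to the coordinate function dual to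
    \<open>x\<close> extracts the coefficient of \<open>x\<close>.\<close>
  have zero: "w x = 0"
    if S: "S \<subseteq> ?E ` Basis" "finite S" and s0: "(\<Sum>x\<in>S. w x *\<^sub>f x) = 0" and x: "x \<in> S" for S w x
  proof -
    from S x obtain b where b: "b \<in> Basis" "x = ?E b" by auto
    have ev: "y (\<lambda>q. c q \<bullet> b) = (if y = x then 1 else 0)" if "y \<in> S" for y
      using that S(1) b coord_vec_coordinate[OF U] inj
      by (auto simp: inner_Basis dest: injD)
    have app: "(\<Sum>x\<in>S. w x *\<^sub>f x) F = (\<Sum>x\<in>S. w x * x F)" for F
      using S(2) by (induction rule: finite_induct) (simp_all add: fscale_def)
    have "0 = (\<Sum>y\<in>S. w y * y (\<lambda>q. c q \<bullet> b))"
      using app[of "\<lambda>q. c q \<bullet> b"] s0 by simp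
    also have "\<dots> = (\<Sum>y\<in>S. if y = x then w y else 0)"
      by (rule sum.cong) (simp_all add: ev)
    also have "\<dots> = w x" using x S(2) by simp
    finally show ?thesis by simp
  qed
  have indep: "fun_space.independent (?E ` Basis)"
    unfolding fun_space.independent_explicit_finite_subsets using zero by blast
  have "B \<subseteq> fun_space.span (?E ` Basis)"
    using TE assms(2) fun_space.span_superset[of B] by blast
  then have 1: "finite B \<and> card B \<le> card (?E ` Basis)"
    using fun_space.independent_span_bound[OF fin assms(1)] by blast
  have "?E ` Basis \<subseteq> fun_space.span B" using ET assms(2) by blast
  then have "card (?E ` Basis) \<le> card B"
    using fun_space.independent_span_bound[OF _ indep] 1 by blast
  with 1 card show "finite B" "card B = DIM('e)" by simp_all
qed

section \<open>Local vector fields\<close>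

lemma smooth_vfieldD:
  assumes "smooth_vfield A W X"
  shows "open W" "p \<in> W \<Longrightarrow> X p \<in> tangent_space A p"
    "open V \<Longrightarrow> V \<subseteq> W \<Longrightarrow> smooth_fun A V f \<Longrightarrow> smooth_fun A V (\<lambda>p. X p f)"
  using assms unfolding smooth_vfield_def by auto

lemma smooth_vfieldI:
  assumes "open W" "\<And>p. p \<in> W \<Longrightarrow> X p \<in> tangent_space A p"
    and "\<And>V f. open V \<Longrightarrow> V \<subseteq> W \<Longrightarrow> smooth_fun A V f \<Longrightarrow> smooth_fun A V (\<lambda>p. X p f)"
  shows "smooth_vfield A W X"
  using assms unfolding smooth_vfield_def by simp

lemma smooth_vfield_subset: "smooth_vfield A W X \<Longrightarrow> open V \<Longrightarrow> V \<subseteq> W \<Longrightarrow> smooth_vfield A V X"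
  unfolding smooth_vfield_def by blast

lemma smooth_vfield_add:
  assumes "smooth_vfield A W X" "smooth_vfield A W Y"
  shows "smooth_vfield A W (\<lambda>q. X q + Y q)"
proof (rule smooth_vfieldI)
  show "smooth_fun A V (\<lambda>p. (X p + Y p) f)" if "open V" "V \<subseteq> W" "smooth_fun A V f" for V f
    using smooth_fun_add[OF that(1) smooth_vfieldD(3)[OF assms(1) that] smooth_vfieldD(3)[OF assms(2) that]]
    by simp
qed (use smooth_vfieldD[OF assms(1)] smooth_vfieldD[OF assms(2)] in simp_all)

lemma smooth_vfield_scale:
  assumes "smooth_fun A W f" "smooth_vfield A W X"
  shows "smooth_vfield A W (\<lambda>q. f q *\<^sub>f X q)"
proof (rule smooth_vfieldI)
  show "smooth_fun A V (\<lambda>p. (f p *\<^sub>f X p) k)" if "open V" "V \<subseteq> W" "smooth_fun A V k" for V k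
    using smooth_fun_mult[OF that(1) smooth_fun_subset[OF assms(1) that(2)] smooth_vfieldD(3)[OF assms(2) that]]
    by (simp add: fscale_def)
qed (use smooth_vfieldD[OF assms(2)] in simp_all)

lemma smooth_vfield_diff:
  assumes "smooth_vfield A W X" "smooth_vfield A W Y"
  shows "smooth_vfield A W (\<lambda>q. X q - Y q)"
proof -
  have "smooth_vfield A W (\<lambda>q. X q + (-1) *\<^sub>f Y q)"
    using assms smooth_vfieldD(1) by (intro smooth_vfield_add smooth_vfield_scale smooth_fun_const)
  moreover have "X q + (-1) *\<^sub>f Y q = X q - Y q" for q by (simp add: fun_eq_iff fscale_def)
  ultimately show ?thesis by simp
qed

lemma smooth_coord_field:
  assumes "(U, c) \<in> A"
  shows "smooth_vfield A U (\<lambda>q. coord_vec A (U, c) q u)"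
proof (rule smooth_vfieldI)
  show "open U" using chart_open assms .
  show "coord_vec A (U, c) q u \<in> tangent_space A q" if "q \<in> U" for q
    using tangent_space_eq[OF assms that] by blast
  fix V f assume Vo: "open V" and VU: "V \<subseteq> U" and f: "smooth_fun A V f"
  have UV: "U \<inter> V = V" using VU by blast
  have "smooth_on (c ` V) (\<lambda>x. frechet_derivative (f \<circ> inv_into U c) (at x) u)"
    using smooth_on_directional_derivative[OF smooth_funD[OF f assms]] by (simp add: UV)
  then have "smooth_on (c ` V) ((\<lambda>q. coord_vec A (U, c) q u f) \<circ> inv_into U c)"
    by (rule smooth_on_cong[rotated 2])
      (use VU Vo f chart_image_open[OF assms Vo] chart_inv[OF assms] smooth_nearI
        in \<open>auto simp: UV coord_vec_def subset_iff\<close>)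
  then show "smooth_fun A V (\<lambda>q. coord_vec A (U, c) q u f)"
    using smooth_funI[OF assms Vo VU] by blast
qed

text \<open>A field with constant coefficients in one chart. A local extension is enough because the
  identities concern fields on arbitrary open sets, so no cut-off function is involved.\<close>

lemma extend_tangent:
  assumes "v \<in> tangent_space A p"
  obtains W X where "p \<in> W" "smooth_vfield A W X" "X p = v"
proof -
  obtain U c where U: "(U, c) \<in> A" "p \<in> U" by (rule chart_exists)
  obtain u where "v = coord_vec A (U, c) p u" using assms tangent_space_eq[OF U] by auto
  then show ?thesis using that[OF U(2) smooth_coord_field[OF U(1)]] by blast
qed

lemma smooth_vfield_cong:
  assumes "smooth_vfield A W X" "\<And>q. q \<in> W \<Longrightarrow> Y q = X q"
  shows "smooth_vfield A W Y"
proof (rule smooth_vfieldI)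
  show "smooth_fun A V (\<lambda>p. Y p f)" if V: "open V" "V \<subseteq> W" "smooth_fun A V f" for V f
    by (rule smooth_fun_cong[OF V(1) _ smooth_vfieldD(3)[OF assms(1) V]])
      (use assms(2) V(2) in auto)
qed (use smooth_vfieldD[OF assms(1)] assms(2) in simp_all)

lemma smooth_vfield_sum:
  assumes "open W" "finite I" "\<And>i. i \<in> I \<Longrightarrow> smooth_vfield A W (X i)"
  shows "smooth_vfield A W (\<lambda>q. \<Sum>i\<in>I. X i q)"
  using assms(2,3)
proof (induction rule: finite_induct)
  case empty
  show ?case
    by (rule smooth_vfieldI)
      (use tangent_space_closed(1) in \<open>simp_all add: assms(1) smooth_fun_const zero_fun_def\<close>)
next
  case (insert i I)
  then show ?case unfolding sum.insert[OF insert.hyps] by (intro smooth_vfield_add) blast+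
qed

lemma lie_bracket_antisym: "lie_bracket A X Y p = - lie_bracket A Y X p"
  by (simp add: lie_bracket_def fun_eq_iff)

text \<open>Expanding the difference of two fields in a coordinate frame, all coefficients vanish at
  \<open>p\<close>.\<close>

lemma tensorial_pointwise:
  fixes F :: "'m vfield \<Rightarrow> 'm tvec"
  assumes add: "\<And>V X Y. p \<in> V \<Longrightarrow> V \<subseteq> W \<Longrightarrow> smooth_vfield A V X \<Longrightarrow> smooth_vfield A V Y \<Longrightarrow>
      F (\<lambda>q. X q + Y q) = F X + F Y"
    and scale: "\<And>V f X. p \<in> V \<Longrightarrow> V \<subseteq> W \<Longrightarrow> smooth_fun A V f \<Longrightarrow> smooth_vfield A V X \<Longrightarrow>
      F (\<lambda>q. f q *\<^sub>f X q) = f p *\<^sub>f F X"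
    and cong: "\<And>V X Y. p \<in> V \<Longrightarrow> V \<subseteq> W \<Longrightarrow> smooth_vfield A V X \<Longrightarrow>
      (\<And>q. q \<in> V \<Longrightarrow> Y q = X q) \<Longrightarrow> F Y = F X"
    and "p \<in> W" and X: "smooth_vfield A W X" and Y: "smooth_vfield A W Y" and "X p = Y p"
  shows "F X = F Y"
proof -
  obtain U c where U: "(U, c) \<in> A" "p \<in> U" by (rule chart_exists)
  \<comment> \<open>The coordinate frame lives on \<open>U\<close> only, which is why the
    assumptions on \<open>F\<close> are imposed for every smaller \<open>V\<close> containing
    \<open>p\<close>.\<close>
  define V where "V = W \<inter> U"
  have V: "open V" "p \<in> V" "V \<subseteq> W" "V \<subseteq> U"
    using smooth_vfieldD(1)[OF X] chart_open[OF U(1)] U(2) \<open>p \<in> W\<close> by (auto simp: V_def)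
  define Z where "Z = (\<lambda>q. X q - Y q)"
  have Z: "smooth_vfield A V Z"
    using smooth_vfield_subset[OF smooth_vfield_diff[OF X Y] V(1,3)] by (simp add: Z_def)
  let ?E = "\<lambda>b q. coord_vec A (U, c) q b" and ?f = "\<lambda>b q. Z q (\<lambda>r. c r \<bullet> b)"
  have E: "smooth_vfield A V (?E b)" for b
    using smooth_vfield_subset[OF smooth_coord_field[OF U(1)] V(1,4)] .
  have f: "smooth_fun A V (?f b)" for b
    using smooth_vfieldD(3)[OF Z V(1) order_refl smooth_fun_subset[OF smooth_coordinate[OF U(1)] V(4)]] .
  have fE: "smooth_vfield A V (\<lambda>q. ?f b q *\<^sub>f ?E b q)" for b
    using smooth_vfield_scale[OF f E] .
  have "F (\<lambda>q. \<Sum>b\<in>I. ?f b q *\<^sub>f ?E b q) = 0" if "finite I" for I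
    using that
  proof (induction rule: finite_induct)
    case empty
    show ?case
      using scale[OF V(2,3) smooth_fun_const[OF V(1), of 0] Z]
      by (simp only: sum.empty fun_space.scale_zero_left)
  next
    case (insert b I)
    have "?f b p = 0" using \<open>X p = Y p\<close> by (simp add: Z_def)
    then have "F (\<lambda>q. ?f b q *\<^sub>f ?E b q) = 0"
      using scale[OF V(2,3) f E] by simp
    then show ?case
      unfolding sum.insert[OF insert.hyps]
      by (subst add[OF V(2,3) fE smooth_vfield_sum[OF V(1) insert.hyps(1) fE]])
        (simp only: insert.IH add_0)
  qed
  from this[OF finite_Basis] have "F (\<lambda>q. \<Sum>b\<in>Basis. ?f b q *\<^sub>f ?E b q) = 0" .
  moreover have "F Z = F (\<lambda>q. \<Sum>b\<in>Basis. ?f b q *\<^sub>f ?E b q)"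
  proof (rule cong[OF V(2,3) smooth_vfield_sum[OF V(1) finite_Basis fE]])
    fix q assume q: "q \<in> V"
    show "Z q = (\<Sum>b\<in>Basis. ?f b q *\<^sub>f ?E b q)"
      using tangent_expand[OF U(1) _ smooth_vfieldD(2)[OF Z q]] q V(4) by blast
  qed
  ultimately have "F Z = 0" by simp
  moreover have "F X = F (\<lambda>q. Z q + Y q)"
    by (rule arg_cong[of _ _ F]) (simp add: Z_def)
  ultimately show ?thesis
    using add[OF V(2,3) Z smooth_vfield_subset[OF Y V(1,3)]] by simp
qed

text \<open>The rank-one part has diagonal entries f(e) z_e, which add up to f(z) by linearity, and
  the identity contributes the dimension. R(., \<zeta>)\<zeta> has this shape with f = \<eta> and z
  = \<zeta>.\<close>

lemma trace_on_rank_one_minus_id: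
  assumes f: "linear_on (tangent_space A p) f" and z: "z \<in> tangent_space A p"
    and F: "\<And>u. u \<in> tangent_space A p \<Longrightarrow> F u = f u *\<^sub>f z - u"
  shows "trace_on (tangent_space A p) F = f z - DIM('e)"
proof -
  let ?T = "tangent_space A p"
  define B where "B = (SOME B. fun_space.independent B \<and> fun_space.span B = ?T)"
  have "\<exists>B. fun_space.independent B \<and> fun_space.span B = ?T"
    using fun_space.basis_exists[of ?T] fun_space.span_minimal[OF _ tangent_space_subspace]
    by (metis subset_antisym)
  then have B: "fun_space.independent B" "fun_space.span B = ?T"
    unfolding B_def by (metis (mono_tags, lifting) someI_ex)+
  note fin = tangent_basis_card[OF B]
  have BT: "B \<subseteq> ?T" using B(2) fun_space.span_superset[of B] by blast
  let ?r = "fun_space.representation B"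
  have "?r (F e) e = f e * ?r z e - 1" if "e \<in> B" for e
  proof -
    have e: "e \<in> ?T" using that BT by blast
    have "?r (f e *\<^sub>f z - e) = (\<lambda>x. f e * ?r z x - ?r e x)"
      using fun_space.representation_diff[OF B(1), of e "f e *\<^sub>f z"]
        fun_space.representation_scale[OF B(1), of z "f e"] B(2) z e by simp
    then show ?thesis
      using fun_space.representation_basis[OF B(1) that] F[OF e] by simp
  qed
  then have "trace_on ?T F = (\<Sum>e\<in>B. f e * ?r z e - 1)"
    unfolding trace_on_def Let_def B_def[symmetric] by simp
  also have "\<dots> = (\<Sum>e\<in>B. ?r z e * f e) - DIM('e)"
    using fin by (simp add: sum_subtractf mult.commute)
  also have "(\<Sum>e\<in>B. ?r z e * f e) = f (\<Sum>e\<in>B. ?r z e *\<^sub>f e)"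
  proof -
    have f0: "f 0 = 0" using linear_onD(2)[OF f, of 0 0] by simp
    \<comment> \<open>\<open>f\<close> is linear on the tangent space only, so the induction carries
      along that the partial sums stay inside.\<close>
    have "(\<Sum>e\<in>I. ?r z e * f e) = f (\<Sum>e\<in>I. ?r z e *\<^sub>f e) \<and> (\<Sum>e\<in>I. ?r z e *\<^sub>f e) \<in> ?T"
      if "finite I" "I \<subseteq> ?T" for I
      using that
    proof (induction rule: finite_induct)
      case empty
      show ?case unfolding sum.empty f0 using tangent_space_closed(1) by blast
    next
      case (insert e I)
      then have e: "e \<in> ?T" and S: "(\<Sum>e\<in>I. ?r z e * f e) = f (\<Sum>e\<in>I. ?r z e *\<^sub>f e)"
        "(\<Sum>e\<in>I. ?r z e *\<^sub>f e) \<in> ?T" by simp_all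
      note re = tangent_space_closed(3)[OF e, of "?r z e"]
      show ?case
        unfolding sum.insert[OF insert.hyps] linear_onD(1)[OF f re S(2)] linear_onD(2)[OF f e] S(1)
        by (rule conjI[OF refl tangent_space_closed(2)[OF re S(2)]])
    qed
    then show ?thesis using fin(1) BT by blast
  qed
  also have "(\<Sum>e\<in>B. ?r z e *\<^sub>f e) = z"
    using fun_space.sum_representation_eq[OF B(1) _ fin(1) order_refl] z B(2) by blast
  finally show ?thesis .
qed

end

section \<open>Tensoriality of the curvature\<close>

locale torsion_free_connection = smooth_manifold A
  for A :: "('m::{second_countable_topology, t2_space}, 'e::euclidean_space) chart set" +
  fixes D :: "'m vfield \<Rightarrow> 'm vfield \<Rightarrow> 'm vfield"
  assumes connection: "affine_connection A D"
    and torsion_free: "\<And>W X Y p. smooth_vfield A W X \<Longrightarrow> smooth_vfield A W Y \<Longrightarrow> p \<in> W \<Longrightarrow>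
      lie_bracket A X Y p = D X Y p - D Y X p"
begin

section \<open>Calculus rules for the connection and the bracket\<close>

lemma D_smooth: "smooth_vfield A W X \<Longrightarrow> smooth_vfield A W Y \<Longrightarrow> smooth_vfield A W (D X Y)"
  using connection[unfolded affine_connection_def, THEN conjunct1] by blast

lemma D_cong:
  "smooth_vfield A W X \<Longrightarrow> smooth_vfield A W Y \<Longrightarrow> (\<And>q. q \<in> W \<Longrightarrow> X' q = X q) \<Longrightarrow>
    (\<And>q. q \<in> W \<Longrightarrow> Y' q = Y q) \<Longrightarrow> p \<in> W \<Longrightarrow> D X' Y' p = D X Y p"
  using connection[unfolded affine_connection_def, THEN conjunct2, THEN conjunct1,
      rule_format, of W X Y X' Y' p] by blast

lemma
  assumes "smooth_vfield A W X" "smooth_vfield A W Y" "p \<in> W"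
  shows D_add1: "smooth_vfield A W Z \<Longrightarrow> D (\<lambda>q. X q + Y q) Z p = D X Z p + D Y Z p"
    and D_add2: "smooth_vfield A W Z \<Longrightarrow> D X (\<lambda>q. Y q + Z q) p = D X Y p + D X Z p"
    and D_scale1: "smooth_fun A W f \<Longrightarrow> D (\<lambda>q. f q *\<^sub>f X q) Y p = f p *\<^sub>f D X Y p"
    and D_scale2: "smooth_fun A W f \<Longrightarrow> D X (\<lambda>q. f q *\<^sub>f Y q) p = f p *\<^sub>f D X Y p + X p f *\<^sub>f Y p"
proof -
  note * = connection[unfolded affine_connection_def, THEN conjunct2, THEN conjunct2, rule_format]
  show "smooth_vfield A W Z \<Longrightarrow> D (\<lambda>q. X q + Y q) Z p = D X Z p + D Y Z p"
    using *[of W X Y Z "\<lambda>q. 0" p] assms smooth_fun_const[OF smooth_vfieldD(1)] by blast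
  show "smooth_vfield A W Z \<Longrightarrow> D X (\<lambda>q. Y q + Z q) p = D X Y p + D X Z p"
    using *[of W X Y Z "\<lambda>q. 0" p] assms smooth_fun_const[OF smooth_vfieldD(1)] by blast
  show "smooth_fun A W f \<Longrightarrow> D (\<lambda>q. f q *\<^sub>f X q) Y p = f p *\<^sub>f D X Y p"
    using *[of W X X Y f p] assms by blast
  show "smooth_fun A W f \<Longrightarrow> D X (\<lambda>q. f q *\<^sub>f Y q) p = f p *\<^sub>f D X Y p + X p f *\<^sub>f Y p"
    using *[of W X Y Y f p] assms by blast
qed

lemma D_diff2:
  assumes "smooth_vfield A W X" "smooth_vfield A W Y" "smooth_vfield A W Z" "p \<in> W"
  shows "D X (\<lambda>q. Y q - Z q) p = D X Y p - D X Z p"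
  using D_add2[OF assms(1) smooth_vfield_diff[OF assms(2,3)] assms(4,3)] by (simp add: algebra_simps)

text \<open>Vanishing torsion writes the bracket as a difference of covariant derivatives, which are
  smooth fields by the connection axioms. A direct proof that [X, Y] is a tangent vector would go
  through the symmetry of second derivatives.\<close>

lemma lie_bracket_smooth:
  assumes "smooth_vfield A W X" "smooth_vfield A W Y"
  shows "smooth_vfield A W (lie_bracket A X Y)"
  by (rule smooth_vfield_cong[OF smooth_vfield_diff[OF D_smooth[OF assms] D_smooth[OF assms(2,1)]]])
    (rule torsion_free[OF assms])

lemma lie_bracket_cong:
  assumes "smooth_vfield A W X" "smooth_vfield A W Y" "\<And>q. q \<in> W \<Longrightarrow> Y' q = Y q" "p \<in> W"
  shows "lie_bracket A X Y' p = lie_bracket A X Y p"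
  using torsion_free[OF assms(1,2,4)] torsion_free[OF assms(1) smooth_vfield_cong[OF assms(2,3)] assms(4)]
    D_cong[OF assms(1,2) refl assms(3,4)] D_cong[OF assms(2,1) assms(3) refl assms(4)] by simp

lemma lie_bracket_add:
  assumes "smooth_vfield A W X" "smooth_vfield A W Y" "smooth_vfield A W Z" "p \<in> W"
  shows "lie_bracket A X (\<lambda>q. Y q + Z q) p = lie_bracket A X Y p + lie_bracket A X Z p"
  using torsion_free[OF assms(1) smooth_vfield_add[OF assms(2,3)] assms(4)]
    torsion_free[OF assms(1,2,4)] torsion_free[OF assms(1,3,4)]
    D_add2[OF assms(1,2,4,3)] D_add1[OF assms(2,3,4,1)] by simp

lemma lie_bracket_scale:
  assumes "smooth_vfield A W X" "smooth_vfield A W Y" "smooth_fun A W f" "p \<in> W"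
  shows "lie_bracket A X (\<lambda>q. f q *\<^sub>f Y q) p = f p *\<^sub>f lie_bracket A X Y p + X p f *\<^sub>f Y p"
  using torsion_free[OF assms(1) smooth_vfield_scale[OF assms(3,2)] assms(4)]
    torsion_free[OF assms(1,2,4)]
    D_scale2[OF assms(1,2,4,3)] D_scale1[OF assms(2,1,4,3)]
  by (simp add: fun_space.scale_right_diff_distrib)

text \<open>Prepares \<open>curvature_at\<close>, which ranges over all fields with prescribed
  values at \<open>p\<close>: a field agreeing with \<zeta> at \<open>p\<close> may then be
  exchanged for \<zeta> itself.\<close>

lemma curvature_pointwise3:
  assumes X: "smooth_vfield A W X" and Y: "smooth_vfield A W Y" and "p \<in> W"
    and "smooth_vfield A W Z" "smooth_vfield A W Z'" "Z p = Z' p"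
  shows "curvature A D X Y Z p = curvature A D X Y Z' p"
proof (rule tensorial_pointwise[where F = "\<lambda>Z. curvature A D X Y Z p", OF _ _ _ assms(3-6)])
  fix V assume p: "p \<in> V" and V: "V \<subseteq> W"
  {
    fix Z Z' assume Z: "smooth_vfield A V Z" and Z': "smooth_vfield A V Z'"
    note Vo = smooth_vfieldD(1)[OF Z]
    note X = smooth_vfield_subset[OF X Vo V] and Y = smooth_vfield_subset[OF Y Vo V]
    have "D S (D T (\<lambda>q. Z q + Z' q)) p = D S (D T Z) p + D S (D T Z') p"
      if S: "smooth_vfield A V S" and T: "smooth_vfield A V T" for S T
    proof -
      have "D S (D T (\<lambda>q. Z q + Z' q)) p = D S (\<lambda>q. D T Z q + D T Z' q) p"
        by (rule D_cong[OF S smooth_vfield_add[OF D_smooth[OF T Z] D_smooth[OF T Z']] refl D_add2[OF T Z _ Z'] p])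
      then show ?thesis using D_add2[OF S D_smooth[OF T Z] p D_smooth[OF T Z']] by simp
    qed
    from this[OF X Y] this[OF Y X] D_add2[OF lie_bracket_smooth[OF X Y] Z p Z']
    show "curvature A D X Y (\<lambda>q. Z q + Z' q) p = curvature A D X Y Z p + curvature A D X Y Z' p"
      by (simp add: curvature_def)
  next
    fix f Z assume f: "smooth_fun A V f" and Z: "smooth_vfield A V Z"
    note Vo = smooth_vfieldD(1)[OF Z]
    note X = smooth_vfield_subset[OF X Vo V] and Y = smooth_vfield_subset[OF Y Vo V]
    \<comment> \<open>The terms with a first derivative of \<open>f\<close> are symmetric in
      \<open>S\<close> and \<open>T\<close> and cancel in the commutator; only the second derivative
      of \<open>f\<close> survives antisymmetrisation.\<close>
    have "D S (D T (\<lambda>q. f q *\<^sub>f Z q)) p =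
        f p *\<^sub>f D S (D T Z) p + S p f *\<^sub>f D T Z p + (T p f *\<^sub>f D S Z p + S p (\<lambda>q. T q f) *\<^sub>f Z p)"
      if S: "smooth_vfield A V S" and T: "smooth_vfield A V T" for S T
    proof -
      have Tf: "smooth_fun A V (\<lambda>q. T q f)" using smooth_vfieldD(3)[OF T Vo order_refl f] .
      note s1 = smooth_vfield_scale[OF f D_smooth[OF T Z]] and s2 = smooth_vfield_scale[OF Tf Z]
      have "D S (D T (\<lambda>q. f q *\<^sub>f Z q)) p = D S (\<lambda>q. f q *\<^sub>f D T Z q + T q f *\<^sub>f Z q) p"
        by (rule D_cong[OF S smooth_vfield_add[OF s1 s2] refl D_scale2[OF T Z _ f] p])
      also have "\<dots> = D S (\<lambda>q. f q *\<^sub>f D T Z q) p + D S (\<lambda>q. T q f *\<^sub>f Z q) p"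
        by (rule D_add2[OF S s1 p s2])
      finally show ?thesis
        using D_scale2[OF S D_smooth[OF T Z] p f] D_scale2[OF S Z p Tf] by simp
    qed
    note * = this[OF X Y] this[OF Y X]
    \<comment> \<open>The surviving term [X, Y]f Z is cancelled by the Leibniz term of the covariant
      derivative along [X, Y].\<close>
    have "X p (\<lambda>q. Y q f) = lie_bracket A X Y p f + Y p (\<lambda>q. X q f)"
      using smooth_nearI[OF Vo p f] by (simp add: lie_bracket_def)
    then show "curvature A D X Y (\<lambda>q. f q *\<^sub>f Z q) p = f p *\<^sub>f curvature A D X Y Z p"
      using * D_scale2[OF lie_bracket_smooth[OF X Y] Z p f]
      by (simp add: curvature_def fun_eq_iff fscale_def algebra_simps)
  next
    fix Z Z' assume Z: "smooth_vfield A V Z" and eq: "\<And>q. q \<in> V \<Longrightarrow> Z' q = Z q"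
    note Vo = smooth_vfieldD(1)[OF Z]
    note X = smooth_vfield_subset[OF X Vo V] and Y = smooth_vfield_subset[OF Y Vo V]
    have "D S (D T Z') p = D S (D T Z) p"
      if S: "smooth_vfield A V S" and T: "smooth_vfield A V T" for S T
      by (rule D_cong[OF S D_smooth[OF T Z] refl D_cong[OF T Z refl eq] p])
    from this[OF X Y] this[OF Y X] D_cong[OF lie_bracket_smooth[OF X Y] Z refl eq p]
    show "curvature A D X Y Z' p = curvature A D X Y Z p" by (simp add: curvature_def)
  }
qed

lemma curvature_pointwise2:
  assumes X: "smooth_vfield A W X" and Z: "smooth_vfield A W Z" and "p \<in> W"
    and "smooth_vfield A W Y" "smooth_vfield A W Y'" "Y p = Y' p"
  shows "curvature A D X Y Z p = curvature A D X Y' Z p"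
proof (rule tensorial_pointwise[where F = "\<lambda>Y. curvature A D X Y Z p", OF _ _ _ assms(3-6)])
  fix V assume p: "p \<in> V" and V: "V \<subseteq> W"
  {
    fix Y Y' assume Y: "smooth_vfield A V Y" and Y': "smooth_vfield A V Y'"
    note Vo = smooth_vfieldD(1)[OF Y]
    note X = smooth_vfield_subset[OF X Vo V] and Z = smooth_vfield_subset[OF Z Vo V]
    have "D X (D (\<lambda>q. Y q + Y' q) Z) p = D X (\<lambda>q. D Y Z q + D Y' Z q) p"
      by (rule D_cong[OF X smooth_vfield_add[OF D_smooth[OF Y Z] D_smooth[OF Y' Z]] refl D_add1[OF Y Y' _ Z] p])
    moreover have "D (lie_bracket A X (\<lambda>q. Y q + Y' q)) Z p =
        D (\<lambda>q. lie_bracket A X Y q + lie_bracket A X Y' q) Z p"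
      by (rule D_cong[OF smooth_vfield_add[OF lie_bracket_smooth[OF X Y] lie_bracket_smooth[OF X Y']]
            Z lie_bracket_add[OF X Y Y'] refl p])
    ultimately show "curvature A D X (\<lambda>q. Y q + Y' q) Z p = curvature A D X Y Z p + curvature A D X Y' Z p"
      using D_add2[OF X D_smooth[OF Y Z] p D_smooth[OF Y' Z]] D_add1[OF Y Y' p D_smooth[OF X Z]]
        D_add1[OF lie_bracket_smooth[OF X Y] lie_bracket_smooth[OF X Y'] p Z]
      by (simp add: curvature_def)
  next
    fix f Y assume f: "smooth_fun A V f" and Y: "smooth_vfield A V Y"
    note Vo = smooth_vfieldD(1)[OF Y]
    note X = smooth_vfield_subset[OF X Vo V] and Z = smooth_vfield_subset[OF Z Vo V]
    have Xf: "smooth_fun A V (\<lambda>q. X q f)" using smooth_vfieldD(3)[OF X Vo order_refl f] .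
    note s1 = smooth_vfield_scale[OF f lie_bracket_smooth[OF X Y]] and s2 = smooth_vfield_scale[OF Xf Y]
    have "D X (D (\<lambda>q. f q *\<^sub>f Y q) Z) p = D X (\<lambda>q. f q *\<^sub>f D Y Z q) p"
      by (rule D_cong[OF X smooth_vfield_scale[OF f D_smooth[OF Y Z]] refl D_scale1[OF Y Z _ f] p])
    \<comment> \<open>The extra summand \<open>X q f *\<^sub>f Y q\<close> offsets the Leibniz term
      coming from the derivative of \<open>f q *\<^sub>f D Y Z q\<close> along
      \<open>X\<close>.\<close>
    moreover have "D (lie_bracket A X (\<lambda>q. f q *\<^sub>f Y q)) Z p =
        D (\<lambda>q. f q *\<^sub>f lie_bracket A X Y q + X q f *\<^sub>f Y q) Z p"
      by (rule D_cong[OF smooth_vfield_add[OF s1 s2] Z lie_bracket_scale[OF X Y f] refl p])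
    ultimately show "curvature A D X (\<lambda>q. f q *\<^sub>f Y q) Z p = f p *\<^sub>f curvature A D X Y Z p"
      using D_add1[OF s1 s2 p Z] D_scale1[OF lie_bracket_smooth[OF X Y] Z p f] D_scale1[OF Y Z p Xf]
        D_scale2[OF X D_smooth[OF Y Z] p f] D_scale1[OF Y D_smooth[OF X Z] p f]
      by (simp add: curvature_def fun_eq_iff fscale_def algebra_simps)
  next
    fix Y Y' assume Y: "smooth_vfield A V Y" and eq: "\<And>q. q \<in> V \<Longrightarrow> Y' q = Y q"
    note Vo = smooth_vfieldD(1)[OF Y]
    note X = smooth_vfield_subset[OF X Vo V] and Z = smooth_vfield_subset[OF Z Vo V]
    have "D X (D Y' Z) p = D X (D Y Z) p"
      by (rule D_cong[OF X D_smooth[OF Y Z] refl D_cong[OF Y Z eq refl] p])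
    moreover have "D (lie_bracket A X Y') Z p = D (lie_bracket A X Y) Z p"
      by (rule D_cong[OF lie_bracket_smooth[OF X Y] Z lie_bracket_cong[OF X Y eq] refl p])
    ultimately show "curvature A D X Y' Z p = curvature A D X Y Z p"
      using D_cong[OF Y D_smooth[OF X Z] eq refl p] by (simp add: curvature_def)
  }
qed

end

section \<open>Para-Kenmotsu manifolds\<close>

locale para_kenmotsu_manifold = torsion_free_connection A D
  for A :: "('m::{second_countable_topology, t2_space}, 'e::euclidean_space) chart set"
    and D :: "'m vfield \<Rightarrow> 'm vfield \<Rightarrow> 'm vfield" +
  fixes n :: nat and \<phi> :: "'m tensor11" and \<zeta> :: "'m vfield" and \<eta> :: "'m form1" and g :: "'m form2"
  assumes para_kenmotsu: "para_kenmotsu n A \<phi> \<zeta> \<eta> g"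
    and metric_connection: "\<And>W X Y Z p. smooth_vfield A W X \<Longrightarrow> smooth_vfield A W Y \<Longrightarrow>
      smooth_vfield A W Z \<Longrightarrow> p \<in> W \<Longrightarrow>
      X p (\<lambda>q. g q (Y q) (Z q)) = g p (D X Y p) (Z p) + g p (Y p) (D X Z p)"
begin

section \<open>Pointwise algebra of the structure tensors\<close>

abbreviation "T \<equiv> tangent_space A"

lemma almost_paracontact: "almost_paracontact_metric n A \<phi> \<zeta> \<eta> g"
  using para_kenmotsu unfolding para_kenmotsu_def by (rule conjunct1)

lemma phi_tensor: "smooth_tensor11 A \<phi>"
  and zeta_smooth: "smooth_vfield A UNIV \<zeta>"
  and eta_form: "smooth_form1 A \<eta>"
  and metric: "semi_riemannian_metric A g"
  and phi_phi: "v \<in> T p \<Longrightarrow> \<phi> p (\<phi> p v) = v - \<eta> p v *\<^sub>f \<zeta> p"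
  and eta_zeta: "\<eta> p (\<zeta> p) = 1"
  and g_phi_phi: "v \<in> T p \<Longrightarrow> w \<in> T p \<Longrightarrow> g p (\<phi> p v) (\<phi> p w) = - g p v w + \<eta> p v * \<eta> p w"
  using almost_paracontact unfolding almost_paracontact_metric_def by auto

lemma zeta_tangent [simp]: "\<zeta> p \<in> T p"
  using smooth_vfieldD(2)[OF zeta_smooth] by simp

lemma zeta_smooth_on: "open W \<Longrightarrow> smooth_vfield A W \<zeta>"
  using smooth_vfield_subset[OF zeta_smooth] by simp

lemma phi_endomorphism: "endomorphism_on (T p) (\<phi> p)"
  and phi_smooth: "smooth_vfield A W X \<Longrightarrow> smooth_vfield A W (\<lambda>q. \<phi> q (X q))"
  using phi_tensor unfolding smooth_tensor11_def by blast+

lemma phi_tangent [simp]: "v \<in> T p \<Longrightarrow> \<phi> p v \<in> T p"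
  and phi_add: "v \<in> T p \<Longrightarrow> w \<in> T p \<Longrightarrow> \<phi> p (v + w) = \<phi> p v + \<phi> p w"
  and phi_scale: "v \<in> T p \<Longrightarrow> \<phi> p (k *\<^sub>f v) = k *\<^sub>f \<phi> p v"
  using phi_endomorphism[of p] unfolding endomorphism_on_def by blast+

lemma phi_zero: "\<phi> p 0 = 0"
  using phi_scale[of 0 p 0] by simp

lemma phi_diff: "v \<in> T p \<Longrightarrow> w \<in> T p \<Longrightarrow> \<phi> p (v - w) = \<phi> p v - \<phi> p w"
  using phi_add[of "v - w" p w] by (simp add: algebra_simps)

lemma phi_minus: "v \<in> T p \<Longrightarrow> \<phi> p (- v) = - \<phi> p v"
  using phi_diff[of 0 p v] phi_zero by simp

lemma eta_linear: "linear_on (T p) (\<eta> p)"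
  and eta_smooth: "smooth_vfield A W X \<Longrightarrow> smooth_fun A W (\<lambda>q. \<eta> q (X q))"
  using eta_form unfolding smooth_form1_def by blast+

lemma linear_on_diff:
  assumes "linear_on (T p) f" "v \<in> T p" "w \<in> T p"
  shows "f (v - w) = f v - f w"
  using linear_onD(1)[OF assms(1), of "v - w" w] assms by simp

lemma linear_on_zero: "linear_on (T p) f \<Longrightarrow> f 0 = 0"
  using linear_onD(2)[of "T p" f 0 0] by simp

lemma g_linear: "v \<in> T p \<Longrightarrow> linear_on (T p) (g p v)"
  and g_sym: "v \<in> T p \<Longrightarrow> w \<in> T p \<Longrightarrow> g p v w = g p w v"
  and g_nondegenerate: "v \<in> T p \<Longrightarrow> (\<And>w. w \<in> T p \<Longrightarrow> g p v w = 0) \<Longrightarrow> v = 0"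
  using metric unfolding semi_riemannian_metric_def by blast+

lemma g_diff_right: "u \<in> T p \<Longrightarrow> v \<in> T p \<Longrightarrow> w \<in> T p \<Longrightarrow> g p u (v - w) = g p u v - g p u w"
  using linear_on_diff[OF g_linear] by blast

lemma g_scale_right: "u \<in> T p \<Longrightarrow> v \<in> T p \<Longrightarrow> g p u (k *\<^sub>f v) = k * g p u v"
  using linear_onD(2)[OF g_linear] by blast

lemma g_minus_right: "u \<in> T p \<Longrightarrow> v \<in> T p \<Longrightarrow> g p u (- v) = - g p u v"
  using g_diff_right[of u p 0 v] linear_on_zero[OF g_linear] by simp

lemma g_diff_left: "u \<in> T p \<Longrightarrow> v \<in> T p \<Longrightarrow> w \<in> T p \<Longrightarrow> g p (v - w) u = g p v u - g p w u"
  using g_diff_right[of u p v w] g_sym[of u p] by simp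

lemma g_scale_left: "u \<in> T p \<Longrightarrow> v \<in> T p \<Longrightarrow> g p (k *\<^sub>f v) u = k * g p v u"
  using g_scale_right[of u p v] g_sym[of u p] by simp

lemma zeta_nonzero: "\<zeta> p \<noteq> 0"
  using eta_zeta[of p] linear_on_zero[OF eta_linear, of p] by force

text \<open>\<open>\<phi>\<^sup>2\<zeta> = 0\<close>, so \<open>\<phi>\<^sup>3\<zeta> = 0\<close> reads \<open>\<phi>\<zeta> = c\<zeta>\<close>, and then \<open>c\<^sup>2 = 0\<close>.\<close>

lemma phi_zeta: "\<phi> p (\<zeta> p) = 0"
proof -
  have pp: "\<phi> p (\<phi> p (\<zeta> p)) = 0"
    using phi_phi[of "\<zeta> p" p] eta_zeta by simp
  define k where "k = \<eta> p (\<phi> p (\<zeta> p))"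
  have "\<phi> p (\<phi> p (\<phi> p (\<zeta> p))) = \<phi> p (\<zeta> p) - k *\<^sub>f \<zeta> p"
    unfolding k_def by (rule phi_phi) simp
  then have k: "\<phi> p (\<zeta> p) = k *\<^sub>f \<zeta> p"
    unfolding pp phi_zero by (metis eq_iff_diff_eq_0)
  then have "k *\<^sub>f k *\<^sub>f \<zeta> p = 0" using pp phi_scale[of "\<zeta> p" p k] by simp
  then have "k = 0" using zeta_nonzero[of p] by simp
  then show ?thesis using k by simp
qed

text \<open>Two readings of \<phi>^3: \<phi> after \<phi>^2 gives \<phi> because \<phi>\<zeta> = 0,
  while \<phi>^2 after \<phi> gives \<phi> minus \<eta>(\<phi>v)\<zeta>.\<close>

lemma eta_phi:
  assumes "v \<in> T p"
  shows "\<eta> p (\<phi> p v) = 0"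
proof -
  have "\<phi> p (\<phi> p (\<phi> p v)) = \<phi> p v - \<eta> p (\<phi> p v) *\<^sub>f \<zeta> p"
    by (rule phi_phi) (simp add: assms)
  moreover have "\<phi> p (\<phi> p (\<phi> p v)) = \<phi> p v"
    using phi_phi[OF assms] assms by (simp add: phi_diff phi_scale phi_zeta)
  ultimately have "\<eta> p (\<phi> p v) *\<^sub>f \<zeta> p = 0" by simp
  then show ?thesis using zeta_nonzero[of p] by simp
qed

lemma g_zero_right: "v \<in> T p \<Longrightarrow> g p v 0 = 0"
  using linear_on_zero[OF g_linear] .

text \<open>Compatibility of g and \<phi> with second argument \<zeta>, where \<phi>\<zeta> = 0
  kills the left side.\<close>

lemma g_zeta_right: "v \<in> T p \<Longrightarrow> g p v (\<zeta> p) = \<eta> p v"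
  using g_phi_phi[of v p "\<zeta> p"] phi_zeta eta_zeta by (simp add: g_zero_right)

text \<open>Compatibility applied to v and \<phi>w; the \<zeta>-part of \<phi>^2 w drops out since
  \<eta>(\<phi>v) = 0. This makes \<Phi> skew-symmetric.\<close>

lemma g_phi_left:
  assumes "v \<in> T p" "w \<in> T p"
  shows "g p (\<phi> p v) w = - g p v (\<phi> p w)"
proof -
  have "g p (\<phi> p v) (\<phi> p (\<phi> p w)) = g p (\<phi> p v) w"
    using assms phi_phi[OF assms(2)] by (simp add: g_diff_right g_scale_right g_zeta_right eta_phi)
  then show ?thesis using g_phi_phi[OF assms(1), of "\<phi> p w"] assms eta_phi by simp
qed

section \<open>Lie derivatives along the characteristic field\<close>

lemma eta_closed:
  assumes "smooth_vfield A W X" "smooth_vfield A W Y" "p \<in> W"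
  shows "\<eta> p (lie_bracket A X Y p) = X p (\<lambda>q. \<eta> q (Y q)) - Y p (\<lambda>q. \<eta> q (X q))"
proof -
  have "\<forall>W X Y. smooth_vfield A W X \<and> smooth_vfield A W Y \<longrightarrow> (\<forall>p\<in>W. ext_deriv1 A \<eta> X Y p = 0)"
    using para_kenmotsu unfolding para_kenmotsu_def by (elim conjE)
  then have "ext_deriv1 A \<eta> X Y p = 0" using assms by blast
  then show ?thesis unfolding ext_deriv1_def by simp
qed

lemma eta_bracket_zeta:
  assumes X: "smooth_vfield A W X" and p: "p \<in> W"
  shows "\<eta> p (lie_bracket A X \<zeta> p) = - \<zeta> p (\<lambda>q. \<eta> q (X q))"
  using eta_closed[OF X zeta_smooth_on[OF smooth_vfieldD(1)[OF X]] p]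
    tangent_const[OF smooth_vfieldD(2)[OF X p]] by (simp add: eta_zeta)

lemma lie_bracket_zero_right: "X p \<in> T p \<Longrightarrow> lie_bracket A X (\<lambda>q. 0) p = 0"
  by (simp add: lie_bracket_def fun_eq_iff tangent_const)

text \<open>Normality evaluated on \<open>(X, \<zeta>)\<close> says that \<open>\<phi>\<close> is invariant under the flow of \<open>\<zeta>\<close>.\<close>

lemma phi_bracket_zeta:
  assumes X: "smooth_vfield A W X" and p: "p \<in> W"
  shows "\<phi> p (lie_bracket A X \<zeta> p) = lie_bracket A (\<lambda>q. \<phi> q (X q)) \<zeta> p"
proof -
  let ?X = "\<lambda>q. \<phi> q (X q)" and ?a = "lie_bracket A X \<zeta> p" and ?b = "lie_bracket A (\<lambda>q. \<phi> q (X q)) \<zeta> p"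
  note W = smooth_vfieldD(1)[OF X]
  note zeta = zeta_smooth_on[OF W] and X' = phi_smooth[OF X]
  have T [simp]: "X p \<in> T p" "?X p \<in> T p" "?a \<in> T p" "?b \<in> T p"
    using smooth_vfieldD(2)[OF X p] smooth_vfieldD(2)[OF lie_bracket_smooth[OF X zeta] p]
      smooth_vfieldD(2)[OF lie_bracket_smooth[OF X' zeta] p] by simp_all
  have "\<forall>W X Y. smooth_vfield A W X \<and> smooth_vfield A W Y \<longrightarrow>
      (\<forall>p\<in>W. nijenhuis A \<phi> X Y p - (2 * ext_deriv1 A \<eta> X Y p) *\<^sub>f \<zeta> p = 0)"
    using para_kenmotsu unfolding para_kenmotsu_def normal_structure_def by (elim conjE)
  then have "nijenhuis A \<phi> X \<zeta> p - (2 * ext_deriv1 A \<eta> X \<zeta> p) *\<^sub>f \<zeta> p = 0"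
    using X zeta p by blast
  moreover have "ext_deriv1 A \<eta> X \<zeta> p = 0"
    unfolding ext_deriv1_def using eta_closed[OF X zeta p] by simp
  ultimately have "nijenhuis A \<phi> X \<zeta> p = 0"
    by (simp only: mult_zero_right fun_space.scale_zero_left diff_0_right)
  moreover have "nijenhuis A \<phi> X \<zeta> p = \<phi> p (\<phi> p ?a) - \<phi> p ?b"
    unfolding nijenhuis_def phi_zeta
    by (simp only: lie_bracket_zero_right T phi_zero add_0_right diff_0_right)
  \<comment> \<open>\<phi> annihilates multiples of \<zeta>, so this determines the difference only
    up to such a multiple; evaluating \<eta> shows that the multiple is 0.\<close>
  ultimately have "\<phi> p (\<phi> p ?a - ?b) = 0"
    using phi_diff[of "\<phi> p ?a" p ?b] by simp
  then have "\<phi> p ?a - ?b - \<eta> p (\<phi> p ?a - ?b) *\<^sub>f \<zeta> p = 0"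
    using phi_phi[of "\<phi> p ?a - ?b" p] phi_zero by simp
  moreover have "\<eta> p ?b = 0"
    unfolding eta_bracket_zeta[OF X' p]
    using tangent_locally_const[OF zeta_tangent W p eta_phi[OF smooth_vfieldD(2)[OF X]]] by simp
  then have "\<eta> p (\<phi> p ?a - ?b) = 0"
    using linear_on_diff[OF eta_linear, of "\<phi> p ?a" p ?b] eta_phi by simp
  ultimately show ?thesis by simp
qed

text \<open>The left side is the Lie derivative of \<Phi> along \<zeta>. As \<Phi>(\<zeta>, .) = 0,
  Cartan's formula reduces it to the contraction of d\<Phi>, and likewise only \<eta>(\<zeta>)\<Phi>
  = \<Phi> survives in the wedge product. The factors 1/3 of both normalisations cancel.\<close>

lemma lie_zeta_fundamental_form:
  assumes X: "smooth_vfield A W X" and Y: "smooth_vfield A W Y" and p: "p \<in> W"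
  shows "\<zeta> p (\<lambda>q. g q (X q) (\<phi> q (Y q))) - g p (lie_bracket A \<zeta> X p) (\<phi> p (Y p))
    - g p (X p) (\<phi> p (lie_bracket A \<zeta> Y p)) = 2 * g p (X p) (\<phi> p (Y p))"
proof -
  note W = smooth_vfieldD(1)[OF X]
  note zeta = zeta_smooth_on[OF W]
  have T [simp]: "X p \<in> T p" "Y p \<in> T p" "lie_bracket A \<zeta> X p \<in> T p" "lie_bracket A \<zeta> Y p \<in> T p"
    "lie_bracket A X Y p \<in> T p"
    using smooth_vfieldD(2)[OF X p] smooth_vfieldD(2)[OF Y p]
      smooth_vfieldD(2)[OF lie_bracket_smooth[OF zeta X] p]
      smooth_vfieldD(2)[OF lie_bracket_smooth[OF zeta Y] p]
      smooth_vfieldD(2)[OF lie_bracket_smooth[OF X Y] p] by simp_all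
  have "\<forall>W X Y Z. smooth_vfield A W X \<and> smooth_vfield A W Y \<and> smooth_vfield A W Z \<longrightarrow>
      (\<forall>p\<in>W. ext_deriv2 A (fundamental_form \<phi> g) X Y Z p =
        2 * wedge12 \<eta> (fundamental_form \<phi> g) p (X p) (Y p) (Z p))"
    using para_kenmotsu unfolding para_kenmotsu_def by (elim conjE)
  then have "ext_deriv2 A (fundamental_form \<phi> g) \<zeta> X Y p =
      2 * wedge12 \<eta> (fundamental_form \<phi> g) p (\<zeta> p) (X p) (Y p)"
    using X Y zeta p by blast
  moreover have "X p (\<lambda>q. g q (Y q) 0) = 0"
    by (rule tangent_locally_const[OF T(1) W p]) (rule g_zero_right[OF smooth_vfieldD(2)[OF Y]])
  moreover have zero: "g q (\<zeta> q) (\<phi> q (X q)) = 0" if "q \<in> W" for q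
    using g_sym[of "\<zeta> q" q "\<phi> q (X q)"] g_zeta_right[of "\<phi> q (X q)" q] eta_phi[of "X q" q]
      smooth_vfieldD(2)[OF X that] by simp
  then have "Y p (\<lambda>q. g q (\<zeta> q) (\<phi> q (X q))) = 0"
    by (rule tangent_locally_const[OF T(2) W p])
  moreover have "g p (lie_bracket A Y \<zeta> p) (\<phi> p (X p)) = g p (X p) (\<phi> p (lie_bracket A \<zeta> Y p))"
    unfolding lie_bracket_antisym[of Y \<zeta> p]
    using g_sym[of "- lie_bracket A \<zeta> Y p" p "\<phi> p (X p)"] g_phi_left[of "X p" p "lie_bracket A \<zeta> Y p"]
    by (simp add: g_minus_right)
  ultimately show ?thesis
    by (simp add: ext_deriv2_def wedge12_def fundamental_form_def phi_zeta g_zero_right eta_zeta zero[OF p])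
qed

section \<open>The covariant derivative of the characteristic field\<close>

lemma nabla_zeta_symmetric:
  assumes X: "smooth_vfield A W X" and Y: "smooth_vfield A W Y" and p: "p \<in> W"
  shows "g p (D X \<zeta> p) (Y p) = g p (D Y \<zeta> p) (X p)"
proof -
  note W = smooth_vfieldD(1)[OF X]
  note zeta = zeta_smooth_on[OF W]
  have T [simp]: "X p \<in> T p" "Y p \<in> T p" "D X Y p \<in> T p" "D Y X p \<in> T p" "D X \<zeta> p \<in> T p" "D Y \<zeta> p \<in> T p"
    using smooth_vfieldD(2)[OF X p] smooth_vfieldD(2)[OF Y p]
      smooth_vfieldD(2)[OF D_smooth[OF X Y] p] smooth_vfieldD(2)[OF D_smooth[OF Y X] p]
      smooth_vfieldD(2)[OF D_smooth[OF X zeta] p] smooth_vfieldD(2)[OF D_smooth[OF Y zeta] p] by simp_all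
  \<comment> \<open>Differentiating \<eta>(R) = g(R, \<zeta>). Antisymmetrised, the terms \<eta>(D S
    R) become \<eta> of the bracket, so closedness of \<eta> leaves exactly the symmetry of
    \<nabla>\<zeta>.\<close>
  have *: "S p (\<lambda>q. \<eta> q (R q)) = \<eta> p (D S R p) + g p (R p) (D S \<zeta> p)"
    if S: "smooth_vfield A W S" and R: "smooth_vfield A W R" for S R
  proof -
    have "S p (\<lambda>q. \<eta> q (R q)) = S p (\<lambda>q. g q (R q) (\<zeta> q))"
      by (rule tangent_local[OF smooth_vfieldD(2)[OF S p] W p])
        (simp add: g_zeta_right smooth_vfieldD(2)[OF R])
    then show ?thesis
      using metric_connection[OF S R zeta p] g_zeta_right[OF smooth_vfieldD(2)[OF D_smooth[OF S R] p]]
      by simp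
  qed
  show ?thesis
    using eta_closed[OF X Y p] *[OF X Y] *[OF Y X] g_sym[of "X p" p "D Y \<zeta> p"] g_sym[of "Y p" p "D X \<zeta> p"]
    by (simp add: torsion_free[OF X Y p] linear_on_diff[OF eta_linear])
qed

text \<open>Because \<phi> is invariant along \<zeta>, the Lie derivative of \<Phi> on (X, Y) is
  that of g on (X, \<phi>Y). By the symmetry of \<nabla>\<zeta> the latter equals twice the left
  side, and both factors 2 cancel.\<close>

lemma g_nabla_zeta_phi:
  assumes X: "smooth_vfield A W X" and Y: "smooth_vfield A W Y" and p: "p \<in> W"
  shows "g p (D X \<zeta> p) (\<phi> p (Y p)) = g p (X p) (\<phi> p (Y p))"
proof -
  note W = smooth_vfieldD(1)[OF X]
  note zeta = zeta_smooth_on[OF W] and Y' = phi_smooth[OF Y]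
  let ?Y = "\<lambda>q. \<phi> q (Y q)"
  have T [simp]: "X p \<in> T p" "Y p \<in> T p" "D \<zeta> X p \<in> T p" "D X \<zeta> p \<in> T p" "D \<zeta> ?Y p \<in> T p" "D ?Y \<zeta> p \<in> T p"
    "lie_bracket A Y \<zeta> p \<in> T p"
    using smooth_vfieldD(2)[OF X p] smooth_vfieldD(2)[OF Y p]
      smooth_vfieldD(2)[OF D_smooth[OF zeta X] p] smooth_vfieldD(2)[OF D_smooth[OF X zeta] p]
      smooth_vfieldD(2)[OF D_smooth[OF zeta Y'] p] smooth_vfieldD(2)[OF D_smooth[OF Y' zeta] p]
      smooth_vfieldD(2)[OF lie_bracket_smooth[OF Y zeta] p] by simp_all
  have "\<phi> p (lie_bracket A \<zeta> Y p) = D \<zeta> ?Y p - D ?Y \<zeta> p"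
    using phi_bracket_zeta[OF Y p] torsion_free[OF Y' zeta p]
    by (simp add: lie_bracket_antisym[of \<zeta> Y] phi_minus)
  then have "g p (D X \<zeta> p) (?Y p) + g p (X p) (D ?Y \<zeta> p) = 2 * g p (X p) (?Y p)"
    using lie_zeta_fundamental_form[OF X Y p] metric_connection[OF zeta X Y' p] torsion_free[OF zeta X p]
    by (simp add: g_diff_left g_diff_right)
  then show ?thesis
    using nabla_zeta_symmetric[OF X Y' p] g_sym[of "X p" p "D ?Y \<zeta> p"] by simp
qed

text \<open>Differentiate the constant g(\<zeta>, \<zeta>) = 1.\<close>

lemma g_nabla_zeta_zeta:
  assumes X: "smooth_vfield A W X" and p: "p \<in> W"
  shows "g p (D X \<zeta> p) (\<zeta> p) = 0"
proof -
  note zeta = zeta_smooth_on[OF smooth_vfieldD(1)[OF X]]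
  have "X p (\<lambda>q. g q (\<zeta> q) (\<zeta> q)) = 0"
    using tangent_const[OF smooth_vfieldD(2)[OF X p]] by (simp add: g_zeta_right eta_zeta)
  then show ?thesis
    using metric_connection[OF X zeta zeta p] g_sym[OF zeta_tangent smooth_vfieldD(2)[OF D_smooth[OF X zeta] p]]
    by simp
qed

text \<open>\<open>g_nabla_zeta_phi\<close> tests only against the image of \<phi>. Inserting
  \<phi>w reaches w - \<eta>(w)\<zeta>, \<open>g_nabla_zeta_zeta\<close> supplies the remaining
  direction, and nondegeneracy of g concludes.\<close>

lemma nabla_zeta:
  assumes X: "smooth_vfield A W X" and p: "p \<in> W"
  shows "D X \<zeta> p = X p - \<eta> p (X p) *\<^sub>f \<zeta> p"
proof -
  note W = smooth_vfieldD(1)[OF X]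
  note zeta = zeta_smooth_on[OF W]
  have T [simp]: "X p \<in> T p" "D X \<zeta> p \<in> T p"
    using smooth_vfieldD(2)[OF X p] smooth_vfieldD(2)[OF D_smooth[OF X zeta] p] by simp_all
  have "D X \<zeta> p - (X p - \<eta> p (X p) *\<^sub>f \<zeta> p) = 0"
  proof (rule g_nondegenerate)
    fix w assume w [simp]: "w \<in> T p"
    then obtain V Y where Y: "p \<in> V" "smooth_vfield A V Y" "Y p = w" by (rule extend_tangent)
    have VW: "open (V \<inter> W)" "p \<in> V \<inter> W" using smooth_vfieldD(1)[OF Y(2)] W Y(1) p by auto
    note X' = smooth_vfield_subset[OF X VW(1) Int_lower2] and Y' = smooth_vfield_subset[OF Y(2) VW(1) Int_lower1]
    have "g p (D X \<zeta> p) (\<phi> p (\<phi> p w)) = g p (X p) (\<phi> p (\<phi> p w))"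
      using g_nabla_zeta_phi[OF X' phi_smooth[OF Y'] VW(2)] Y(3) by simp
    then have "g p (D X \<zeta> p) w = g p (X p) w - \<eta> p w * \<eta> p (X p)"
      using phi_phi[OF w] g_nabla_zeta_zeta[OF X p]
      by (simp add: g_diff_right g_scale_right g_zeta_right)
    then show "g p (D X \<zeta> p - (X p - \<eta> p (X p) *\<^sub>f \<zeta> p)) w = 0"
      using g_sym[of "\<zeta> p" p w] by (simp add: g_diff_left g_scale_left g_zeta_right)
  qed simp
  then show ?thesis by simp
qed

lemma lie_deriv_metric_zeta:
  assumes X: "smooth_vfield A W X" and Y: "smooth_vfield A W Y" and p: "p \<in> W"
  shows "lie_deriv_metric A \<zeta> g X Y p = 2 * (g p (X p) (Y p) - \<eta> p (X p) * \<eta> p (Y p))"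
proof -
  note zeta = zeta_smooth_on[OF smooth_vfieldD(1)[OF X]]
  have T [simp]: "X p \<in> T p" "Y p \<in> T p" "D \<zeta> X p \<in> T p" "D X \<zeta> p \<in> T p" "D \<zeta> Y p \<in> T p" "D Y \<zeta> p \<in> T p"
    using smooth_vfieldD(2)[OF X p] smooth_vfieldD(2)[OF Y p]
      smooth_vfieldD(2)[OF D_smooth[OF zeta X] p] smooth_vfieldD(2)[OF D_smooth[OF X zeta] p]
      smooth_vfieldD(2)[OF D_smooth[OF zeta Y] p] smooth_vfieldD(2)[OF D_smooth[OF Y zeta] p] by simp_all
  have "lie_deriv_metric A \<zeta> g X Y p = g p (D X \<zeta> p) (Y p) + g p (X p) (D Y \<zeta> p)"
    unfolding lie_deriv_metric_def torsion_free[OF zeta X p] torsion_free[OF zeta Y p]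
      metric_connection[OF zeta X Y p]
    by (simp add: g_diff_left g_diff_right)
  then show ?thesis
    using nabla_zeta[OF X p] nabla_zeta[OF Y p] g_sym[of "\<zeta> p" p "Y p"]
    by (simp add: g_diff_left g_diff_right g_scale_left g_scale_right g_zeta_right)
qed

section \<open>Curvature along the characteristic field and the soliton equation\<close>

lemma curvature_zeta_zeta:
  assumes X: "smooth_vfield A W X" and p: "p \<in> W"
  shows "curvature A D X \<zeta> \<zeta> p = \<eta> p (X p) *\<^sub>f \<zeta> p - X p"
proof -
  note W = smooth_vfieldD(1)[OF X]
  note zeta = zeta_smooth_on[OF W]
  note etaX = eta_smooth[OF X]
  have zz: "D \<zeta> \<zeta> q = 0" if "q \<in> W" for q
    using nabla_zeta[OF zeta that] eta_zeta by simp
  \<comment> \<open>\<zeta> is geodesic; its vanishing acceleration is written as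
    \<open>0 *\<^sub>f \<zeta> q\<close> so that the Leibniz rule evaluates the derivative.\<close>
  have "D X (D \<zeta> \<zeta>) p = D X (\<lambda>q. 0 *\<^sub>f \<zeta> q) p"
    by (rule D_cong[OF X smooth_vfield_scale[OF smooth_fun_const[OF W] zeta] refl _ p]) (simp add: zz)
  also have "\<dots> = 0"
    unfolding D_scale2[OF X zeta p smooth_fun_const[OF W]] tangent_const[OF smooth_vfieldD(2)[OF X p]]
    by (simp only: fun_space.scale_zero_left add_0)
  finally have 1: "D X (D \<zeta> \<zeta>) p = 0" .
  have "D \<zeta> (D X \<zeta>) p = D \<zeta> (\<lambda>q. X q - \<eta> q (X q) *\<^sub>f \<zeta> q) p"
    by (rule D_cong[OF zeta smooth_vfield_diff[OF X smooth_vfield_scale[OF etaX zeta]] refl nabla_zeta[OF X] p])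
  also have "\<dots> = D \<zeta> X p - \<zeta> p (\<lambda>q. \<eta> q (X q)) *\<^sub>f \<zeta> p"
    using D_diff2[OF zeta X smooth_vfield_scale[OF etaX zeta] p] D_scale2[OF zeta zeta p etaX] zz[OF p]
    by simp
  finally have 2: "D \<zeta> (D X \<zeta>) p = D \<zeta> X p - \<zeta> p (\<lambda>q. \<eta> q (X q)) *\<^sub>f \<zeta> p" .
  have 3: "D (lie_bracket A X \<zeta>) \<zeta> p = D X \<zeta> p - D \<zeta> X p + \<zeta> p (\<lambda>q. \<eta> q (X q)) *\<^sub>f \<zeta> p"
    using nabla_zeta[OF lie_bracket_smooth[OF X zeta] p]
    unfolding eta_bracket_zeta[OF X p] unfolding torsion_free[OF X zeta p] by simp
  \<comment> \<open>All derivatives of X cancel between the second and third term, which leaves R(X,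
    \<zeta>)\<zeta> = -\<nabla>\<zeta>(X).\<close>
  show ?thesis
    unfolding curvature_def 1 2 3 nabla_zeta[OF X p] by simp
qed

lemma curvature_at_zeta_zeta:
  assumes u: "u \<in> T p"
  shows "curvature_at A D p u (\<zeta> p) (\<zeta> p) = \<eta> p u *\<^sub>f \<zeta> p - u"
proof -
  have *: "curvature A D X Y Z p = \<eta> p u *\<^sub>f \<zeta> p - u"
    if p: "p \<in> W" and X: "smooth_vfield A W X" and Y: "smooth_vfield A W Y" and Z: "smooth_vfield A W Z"
      and eq: "X p = u" "Y p = \<zeta> p" "Z p = \<zeta> p" for W X Y Z
  proof -
    note zeta = zeta_smooth_on[OF smooth_vfieldD(1)[OF X]]
    have "curvature A D X Y Z p = curvature A D X Y \<zeta> p"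
      by (rule curvature_pointwise3[OF X Y p Z zeta eq(3)])
    also have "\<dots> = curvature A D X \<zeta> \<zeta> p"
      by (rule curvature_pointwise2[OF X zeta p Y zeta eq(2)])
    finally show ?thesis using curvature_zeta_zeta[OF X p] eq(1) by simp
  qed
  \<comment> \<open>Uniqueness in the description hinges on an actual extension of \<open>u\<close>:
    with none, every \<open>z\<close> would satisfy it vacuously.\<close>
  obtain W X where X: "p \<in> W" "smooth_vfield A W X" "X p = u" by (rule extend_tangent[OF u])
  show ?thesis
    unfolding curvature_at_def
  proof (rule the_equality)
    fix z
    assume "\<forall>W X Y Z. p \<in> W \<and> smooth_vfield A W X \<and> smooth_vfield A W Y \<and> smooth_vfield A W Z \<and>
      X p = u \<and> Y p = \<zeta> p \<and> Z p = \<zeta> p \<longrightarrow> curvature A D X Y Z p = z"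
    then have "curvature A D X \<zeta> \<zeta> p = z"
      using X zeta_smooth_on[OF smooth_vfieldD(1)[OF X(2)]] by blast
    then show "z = \<eta> p u *\<^sub>f \<zeta> p - u"
      using curvature_zeta_zeta[OF X(2,1)] X(3) by simp
  qed (use * in blast)
qed

lemma ricci_zeta_zeta: "ricci A D p (\<zeta> p) (\<zeta> p) = 1 - real DIM('e)"
  unfolding ricci_def
  using trace_on_rank_one_minus_id[OF eta_linear zeta_tangent curvature_at_zeta_zeta] eta_zeta by simp

lemma eta_einstein_of_soliton:
  assumes soliton: "h_almost_ricci_yamabe_soliton A g D h \<zeta> l \<alpha> \<beta>" and "\<alpha> \<noteq> 0"
  shows "eta_einstein A \<eta> g D"
proof -
  define s where "s p = (l p - \<beta> / 2 * scalar_curvature A g D p)" for p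
  have eq: "h p * (g p v w - \<eta> p v * \<eta> p w) + \<alpha> * ricci A D p v w + s p * g p v w = 0"
    if v: "v \<in> T p" and w: "w \<in> T p" for p v w
  proof -
    obtain V X where X: "p \<in> V" "smooth_vfield A V X" "X p = v" by (rule extend_tangent[OF v])
    obtain W Y where Y: "p \<in> W" "smooth_vfield A W Y" "Y p = w" by (rule extend_tangent[OF w])
    have VW: "open (V \<inter> W)" "p \<in> V \<inter> W"
      using smooth_vfieldD(1)[OF X(2)] smooth_vfieldD(1)[OF Y(2)] X(1) Y(1) by auto
    note X' = smooth_vfield_subset[OF X(2) VW(1) Int_lower1] and Y' = smooth_vfield_subset[OF Y(2) VW(1) Int_lower2]
    have "h p / 2 * lie_deriv_metric A \<zeta> g X Y p + \<alpha> * ricci A D p (X p) (Y p) + s p * g p (X p) (Y p) = 0"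
      using soliton X' Y' VW(2) unfolding h_almost_ricci_yamabe_soliton_def s_def by blast
    then show ?thesis
      unfolding lie_deriv_metric_zeta[OF X' Y' VW(2)] X(3) Y(3)
      by (simp add: algebra_simps)
  qed
  \<comment> \<open>g - \<eta> \<otimes> \<eta> vanishes on (\<zeta>, \<zeta>), so \<open>h\<close>
    drops out here. The factor \<open>DIM('e) - 1\<close> is 2n when the dimension is 2n +
    1.\<close>
  have s: "s p = \<alpha> * (real DIM('e) - 1)" for p
    using eq[OF zeta_tangent zeta_tangent, of p] ricci_zeta_zeta[of p]
    by (simp add: g_zeta_right eta_zeta algebra_simps)
  have h: "smooth_fun A UNIV h" using soliton unfolding h_almost_ricci_yamabe_soliton_def by blast
  \<comment> \<open>Solving for S gives b = h / \<alpha> and a = 1 - \<open>DIM('e)\<close> - b, so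
    that a + b is the value on (\<zeta>, \<zeta>). The subtraction is spelled as a product with -1
    to match closure under sums and products.\<close>
  have b: "smooth_fun A UNIV (\<lambda>p. 1 / \<alpha> * h p)"
    by (intro smooth_fun_mult smooth_fun_const open_UNIV h)
  have a: "smooth_fun A UNIV (\<lambda>p. (1 - real DIM('e)) + (- 1) * (1 / \<alpha> * h p))"
    by (intro smooth_fun_add smooth_fun_mult smooth_fun_const open_UNIV h)
  have "ricci A D p v w = (1 - real DIM('e) + (- 1) * (1 / \<alpha> * h p)) * g p v w + 1 / \<alpha> * h p * (\<eta> p v * \<eta> p w)"
    if "v \<in> T p" "w \<in> T p" for p v w
    using eq[OF that] \<open>\<alpha> \<noteq> 0\<close> unfolding s by (simp add: field_simps)
  with a b show ?thesis unfolding eta_einstein_def by blast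
qed

end

theorem theorem3p1:
  fixes n :: nat
    and A :: "('m::{second_countable_topology, t2_space}, 'e::euclidean_space) chart set"
    and \<phi> :: "'m tensor11" and \<zeta> :: "'m vfield" and \<eta> :: "'m form1" and g :: "'m form2"
    and D :: "'m vfield \<Rightarrow> 'm vfield \<Rightarrow> 'm vfield"
    and h l :: "'m \<Rightarrow> real" and \<alpha> \<beta> :: real
  assumes "n \<ge> 1" and "DIM('e) = 2 * n + 1"
    and "smooth_atlas A"
    and "para_kenmotsu n A \<phi> \<zeta> \<eta> g"
    and "levi_civita A g D"
    and "h_almost_ricci_yamabe_soliton A g D h \<zeta> l \<alpha> \<beta>"
    and "\<alpha> \<noteq> 0" and "\<alpha> \<noteq> 1"
  shows "eta_einstein A \<eta> g D"
proof -
  interpret para_kenmotsu_manifold A D n \<phi> \<zeta> \<eta> g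
  proof
    show "smooth_atlas A" "para_kenmotsu n A \<phi> \<zeta> \<eta> g" by fact+
    show "affine_connection A D"
      using \<open>levi_civita A g D\<close> unfolding levi_civita_def by (rule conjunct1)
    show "lie_bracket A X Y p = D X Y p - D Y X p"
      if "smooth_vfield A W X" "smooth_vfield A W Y" "p \<in> W" for W X Y p
      using \<open>levi_civita A g D\<close>[unfolded levi_civita_def, THEN conjunct2, THEN conjunct1] that by metis
    show "X p (\<lambda>q. g q (Y q) (Z q)) = g p (D X Y p) (Z p) + g p (Y p) (D X Z p)"
      if "smooth_vfield A W X" "smooth_vfield A W Y" "smooth_vfield A W Z" "p \<in> W" for W X Y Z p
      using \<open>levi_civita A g D\<close>[unfolded levi_civita_def, THEN conjunct2, THEN conjunct2] that by blast
  qed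
  show ?thesis by (rule eta_einstein_of_soliton) fact+
qed

end
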